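(* Let $A$ be an AW*-factor of type $\mathrm{II}_1$, with dimension function $D:\mathcal{P}(A)\to[0,1]$ and quasi-trace $Q:A\to\mathbb{C}$, and let $e\in A$ be an idempotent element (i.e. $e^2=e$, not necessarily self-adjoint). Then, for any $\lambda\in\mathbb{C}$, one has $$Q(\lambda e)=\lambda\, D\big(\mathbf{L}(e)\big),$$ where $\mathbf{L}(e)$ denotes the left support projection of $e$.
   Context: An AW*-algebra is a C*-algebra in which the right annihilator of every subset has the form $pA$ for some projection $p$. An AW*-factor is an AW*-algebra with center $\mathbb{C}1$. It is of type $\mathrm{II}_1$ if it is finite ($x^*x=1$ implies $xx^*=1$) and has no nonzero abelian projections (for a projection $p\neq 0$, $pAp$ is never commutative). Notation: $\mathcal{P}(A)=\{p\in A: p=p^*=p^2\}$. For $p,q\in\mathcal{P}(A)$, $p\sim q$ means there is $x\in A$ with $p=x^*x$, $q=xx^*$ (Murray-von Neumann equivalence), and $p\perp q$ means $pq=0$. For $x\in A$, the left support $\mathbf{L}(x)$ is the smallest projection $p\in A$ with $px=x$, and the right support $\mathbf{R}(x)$ is the smallest projection $p\in A$ with $xp=x$. Dimension function: an AW*-factor $A$ of type $\mathrm{II}_1$ has a unique function $D:\mathcal{P}(A)\to[0,1]$ such that $D(p)=D(q)\Leftrightarrow p\sim q$; $D(p+q)=D(p)+D(q)$ whenever $p\perp q$; and $D(1)=1$. Quasi-trace: if $a=a^*\in A$ has finite spectrum, write $a=\sum_{k=1}^n\alpha_kp_k$ with $\alpha_k\in\mathbb{R}$ and $p_k$ pairwise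 orthogonal projections, and put $d(a)=\sum_{k=1}^n\alpha_kD(p_k)$. For arbitrary $a=a^*\in A$, put $q(a)=\lim_{n\to\infty}d(a_n)$, where $(a_n)$ is any sequence of self-adjoint elements with finite spectrum in the AW*-subalgebra $\{a\}''$ generated by $a$ and $1$, converging to $a$ in norm (the limit exists and is independent of the choice of the sequence). For arbitrary $x\in A$, put $Q(x)=q(\mathrm{Re}\,x)+i\,q(\mathrm{Im}\,x)$, where $\mathrm{Re}\,x=\frac12(x+x^* )$ and $\mathrm{Im}\,x=\frac1{2i}(x-x^* )$. The map $Q:A\to\mathbb{C}$ is called the quasi-trace of $A$; it is the unique map such that (i) $Q$ is linear on abelian C*-subalgebras of $A$; (ii) $Q(x^*x)=Q(xx^* )\ge 0$ for all $x\in A$; (iii) $Q(x)=Q(\mathrm{Re}\,x)+iQ(\mathrm{Im}\,x)$ for all $x\in A$; (iv) $Q(1)=1$. One has $Q|_{\mathcal{P}(A)}=D$. ($Q$ is not assumed to be linear on $A$.) *)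

theory Defs
  imports Complex_Main
begin

text \<open>
  Unital complex C*-algebras, as a type class on top of the real Banach algebra classes.
  An AW*-algebra is automatically unital (the right annihilator of the empty set is \<open>A = pA\<close>,
  and then \<open>p\<close> is a unit).  The axiom \<open>norm 1 = 1\<close> of \<open>real_normed_algebra_1\<close> excludes
  only the zero algebra, which is not a factor (and on which no function has \<open>D(1) = 1\<close> and
  \<open>D(0) = 0\<close>).
\<close>

class cstar_algebra = real_normed_algebra_1 + banach +
  fixes scaleC :: "complex \<Rightarrow> 'a \<Rightarrow> 'a"  (infixr \<open>*\<^sub>C\<close> 75)
    and adj :: "'a \<Rightarrow> 'a"
  assumes scaleC_add_right: "c *\<^sub>C (x + y) = c *\<^sub>C x + c *\<^sub>C y"
    and scaleC_add_left: "(b + c) *\<^sub>C x = b *\<^sub>C x + c *\<^sub>C x"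
    and scaleC_scaleC: "b *\<^sub>C (c *\<^sub>C x) = (b * c) *\<^sub>C x"
    and scaleC_of_real: "complex_of_real r *\<^sub>C x = r *\<^sub>R x"
    and mult_scaleC_left: "(c *\<^sub>C x) * y = c *\<^sub>C (x * y)"
    and mult_scaleC_right: "x * (c *\<^sub>C y) = c *\<^sub>C (x * y)"
    and norm_scaleC: "norm (c *\<^sub>C x) = cmod c * norm x"
    and adj_adj: "adj (adj x) = x"
    and adj_add: "adj (x + y) = adj x + adj y"
    and adj_scaleC: "adj (c *\<^sub>C x) = cnj c *\<^sub>C adj x"
    and adj_mult: "adj (x * y) = adj y * adj x"
    and cstar_identity: "norm (adj x * x) = (norm x)\<^sup>2"
begin

definition self_adjoint :: "'a \<Rightarrow> bool" where
  "self_adjoint x \<longleftrightarrow> adj x = x"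

definition projection :: "'a \<Rightarrow> bool" where
  "projection p \<longleftrightarrow> adj p = p \<and> p * p = p"

definition right_annihilator :: "'a set \<Rightarrow> 'a set" where
  "right_annihilator S = {x. \<forall>s\<in>S. s * x = 0}"

definition abelian_projection :: "'a \<Rightarrow> bool" where
  "abelian_projection p \<longleftrightarrow>
     projection p \<and> (\<forall>x y. (p * x * p) * (p * y * p) = (p * y * p) * (p * x * p))"

end

class aw_star_algebra = cstar_algebra +
  assumes right_annihilator_eq:
    "\<exists>p. projection p \<and> right_annihilator S = {p * x | x. True}"

class aw_star_factor = aw_star_algebra +
  assumes center_eq: "{z. \<forall>x. z * x = x * z} = {c *\<^sub>C 1 | c. True}"

class aw_star_factor_II1 = aw_star_factor +
  assumes finite_algebra: "adj x * x = 1 \<Longrightarrow> x * adj x = 1"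
    and no_abelian_projection: "abelian_projection p \<Longrightarrow> p = 0"

definition mvn_equiv :: "'a::cstar_algebra \<Rightarrow> 'a \<Rightarrow> bool" where
  "mvn_equiv p q \<longleftrightarrow> (\<exists>x. p = adj x * x \<and> q = x * adj x)"

text \<open>For projections, \<open>p \<le> q\<close> means \<open>p q = p\<close>.\<close>

definition left_support :: "'a::aw_star_algebra \<Rightarrow> 'a" where
  "left_support x =
     (THE p. projection p \<and> p * x = x \<and> (\<forall>q. projection q \<and> q * x = x \<longrightarrow> p * q = p))"

text \<open>Only the values of \<open>D\<close> at projections are meaningful.\<close>

definition dimension_function :: "('a::aw_star_factor_II1 \<Rightarrow> real) \<Rightarrow> bool" where
  "dimension_function D \<longleftrightarrow>
     (\<forall>p. projection p \<longrightarrow> 0 \<le> D p \<and> D p \<le> 1) \<and>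
     (\<forall>p q. projection p \<and> projection q \<longrightarrow> (D p = D q \<longleftrightarrow> mvn_equiv p q)) \<and>
     (\<forall>p q. projection p \<and> projection q \<and> p * q = 0 \<longrightarrow> D (p + q) = D p + D q) \<and>
     D 1 = 1"

definition spectrum :: "'a::cstar_algebra \<Rightarrow> complex set" where
  "spectrum x = {c. \<not> (\<exists>y. y * (x - c *\<^sub>C 1) = 1 \<and> (x - c *\<^sub>C 1) * y = 1)}"

text \<open>
  A (unital) AW*-subalgebra is a norm-closed *-subalgebra containing, for each of its subsets,
  the projection that generates the right annihilator of that subset in the whole algebra.
  Unitality is the case of the empty subset.  Equivalently, it contains the right supports
  of its elements and the suprema, in the whole algebra, of its sets of projections.
\<close>

definition aw_star_subalgebra :: "'a::aw_star_algebra set \<Rightarrow> bool" where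
  "aw_star_subalgebra B \<longleftrightarrow>
     closed B \<and>
     (\<forall>x\<in>B. \<forall>y\<in>B. x + y \<in> B \<and> x * y \<in> B) \<and>
     (\<forall>x\<in>B. adj x \<in> B \<and> (\<forall>c. c *\<^sub>C x \<in> B)) \<and>
     (\<forall>S p. S \<subseteq> B \<and> projection p \<and> right_annihilator S = {p * x | x. True} \<longrightarrow> p \<in> B)"

definition aw_star_generated :: "'a::aw_star_algebra set \<Rightarrow> 'a set" where
  "aw_star_generated S = \<Inter> {B. aw_star_subalgebra B \<and> S \<subseteq> B}"

definition simple_trace :: "('a::aw_star_factor_II1 \<Rightarrow> real) \<Rightarrow> 'a \<Rightarrow> real" where
  "simple_trace D a =
     (THE r. \<exists>(n::nat) (\<alpha> :: nat \<Rightarrow> real) p.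
        (\<forall>k<n. projection (p k)) \<and> (\<forall>j<n. \<forall>k<n. j \<noteq> k \<longrightarrow> p j * p k = 0) \<and>
        a = (\<Sum>k<n. \<alpha> k *\<^sub>R p k) \<and> r = (\<Sum>k<n. \<alpha> k * D (p k)))"

text \<open>
  \<open>{a}''\<close> is read as the AW*-subalgebra generated by \<open>a\<close> and \<open>1\<close>.  It is contained in the
  bicommutant of \<open>a\<close>, which is also a commutative AW*-subalgebra; approximating sequences from
  either one give the same limit.
\<close>

definition simple_approx :: "'a::aw_star_algebra \<Rightarrow> (nat \<Rightarrow> 'a) \<Rightarrow> bool" where
  "simple_approx a s \<longleftrightarrow>
     (\<forall>n. self_adjoint (s n) \<and> finite (spectrum (s n)) \<and> s n \<in> aw_star_generated {a, 1}) \<and>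
     s \<longlonglongrightarrow> a"

definition quasi_trace_sa :: "('a::aw_star_factor_II1 \<Rightarrow> real) \<Rightarrow> ('a \<Rightarrow> real) \<Rightarrow> bool" where
  "quasi_trace_sa D q \<longleftrightarrow>
     (\<forall>a s. self_adjoint a \<and> simple_approx a s \<longrightarrow> (\<lambda>n. simple_trace D (s n)) \<longlonglongrightarrow> q a)"

definition re_part :: "'a::cstar_algebra \<Rightarrow> 'a" where
  "re_part x = (1 / 2) *\<^sub>C (x + adj x)"

definition im_part :: "'a::cstar_algebra \<Rightarrow> 'a" where
  "im_part x = (1 / (2 * \<i>)) *\<^sub>C (x - adj x)"

text \<open>
  \<open>Q\<close> is the quasi-trace built from the dimension function \<open>D\<close>.  Every self-adjoint element has
  an approximating sequence, so \<open>D\<close> determines \<open>q\<close> on self-adjoint elements, and hence \<open>Q\<close>.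
\<close>

definition quasi_trace :: "('a::aw_star_factor_II1 \<Rightarrow> real) \<Rightarrow> ('a \<Rightarrow> complex) \<Rightarrow> bool" where
  "quasi_trace D Q \<longleftrightarrow>
     (\<exists>q. quasi_trace_sa D q \<and>
          (\<forall>x. Q x = complex_of_real (q (re_part x)) + \<i> * complex_of_real (q (im_part x))))"

end

(*
  Let p = L(e).  Since e = p + x with x = p x (1 - p), the real and imaginary parts of a multiple
  of e have the form a = \<alpha> p + j with j self-adjoint and off-diagonal with respect to p.  The
  element c = a - \<beta> = \<beta> (2 p - 1) + j, where \<beta> = \<alpha>/2, anticommutes with i j (2 p - 1), and hence
  with the sign S of that element.  So S implements an equivalence between the spectral projections of c for (t, \<infinity>) and
  (-\<infinity>, -t), cut down by the support P = S S, and their dimensions cancel.  On 1 - P the element j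
  vanishes, so c is \<beta> (2 p - 1) there, and p P is equivalent to (1 - p) P.  Altogether
  q(a) = \<beta> + \<beta> (D(p) - D(1 - p)) = \<alpha> D(p).

  The spectral projections come from right annihilators of elements max (c - t) 0 of the continuous
  functional calculus.  The estimate |f(a)| \<le> sup |f| behind the calculus is reduced to a unitary u
  with a = K/2 (u + adj u), obtained from the binomial series for a square
  root, and to a coefficient bound for polynomials on the unit circle.
*)
theory Submission
  imports Defs "HOL-Analysis.Analysis" "HOL-Computational_Algebra.Polynomial"
    "HOL-Computational_Algebra.Formal_Power_Series"
begin

subsection \<open>Norms and polynomials in a C*-algebra\<close>

text \<open>Additivity of \<open>q\<close> is available only for commuting elements, and
  \<open>p\<close> need not commute with \<open>j\<close>; so \<open>q\<close> of
  \<open>\<alpha> p + j\<close> cannot be split, and its value has to be read off from the spectral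
  projections of the sum itself. About their dimensions only two things are known: additivity over
  orthogonal projections and invariance under \<open>mvn_equiv\<close>. The shift by
  \<open>\<beta>\<close> makes the spectrum symmetric: it replaces \<open>\<alpha> p\<close> by
  \<open>\<beta> (2 p - 1)\<close>, which changes sign when \<open>p\<close> and
  \<open>1 - p\<close> are exchanged. Now \<open>2 p - 1\<close> and \<open>j\<close> are
  anticommuting self-adjoint elements, so their product anticommutes with both of them; it is
  skew-adjoint, and the factor \<open>\<i>\<close> makes it self-adjoint so that it has a sign. The
  hypothesis on \<open>q\<close> covers every approximating sequence, so one well-chosen sequence
  decides the value. It is built from the spectral projections of \<open>c\<close> and
  \<open>- c\<close> at the points of a grid, with equal weights of opposite sign: then the
  cancellation of dimensions happens separately at each grid point.\<close>

lemma norm_adj [simp]: "norm (adj x) = norm (x :: 'a::cstar_algebra)"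
proof -
  have le: "norm y \<le> norm (adj y)" for y :: 'a
  proof (cases "y = 0")
    case False
    have "norm y * norm y \<le> norm (adj y) * norm y"
      using cstar_identity[of y] norm_mult_ineq[of "adj y" y] by (simp add: power2_eq_square)
    then show ?thesis using False by simp
  qed simp
  show ?thesis using le[of x] le[of "adj x"] by (simp add: adj_adj)
qed

lemma scaleC_one [simp]: "1 *\<^sub>C x = (x :: 'a::cstar_algebra)"
  using scaleC_of_real[of 1 x] by simp

lemma scaleC_0_left [simp]: "0 *\<^sub>C x = (0 :: 'a::cstar_algebra)"
  using scaleC_of_real[of 0 x] by simp

lemma scaleC_0_right [simp]: "c *\<^sub>C (0 :: 'a::cstar_algebra) = 0"
  using scaleC_add_right[of c "0::'a" 0] by simp

lemma adj_0 [simp]: "adj (0 :: 'a::cstar_algebra) = 0"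
  using adj_add[of "0::'a" 0] by simp

lemma adj_1 [simp]: "adj (1 :: 'a::cstar_algebra) = 1"
  using adj_mult[of "adj 1 :: 'a" 1] by (simp add: adj_adj)

lemma scaleC_minus_left: "(- c) *\<^sub>C x = - (c *\<^sub>C (x :: 'a::cstar_algebra))"
  using scaleC_add_left[of "-c" c x] by (simp add: eq_neg_iff_add_eq_0)

lemma scaleC_minus_right: "c *\<^sub>C (- x) = - (c *\<^sub>C (x :: 'a::cstar_algebra))"
  using scaleC_add_right[of c "-x" x] by (simp add: eq_neg_iff_add_eq_0)

lemma scaleC_diff_right: "c *\<^sub>C (x - y) = c *\<^sub>C x - c *\<^sub>C (y :: 'a::cstar_algebra)"
  using scaleC_add_right[of c x "- y"] by (simp add: scaleC_minus_right)

lemma scaleC_diff_left: "(b - c) *\<^sub>C x = b *\<^sub>C x - c *\<^sub>C (x :: 'a::cstar_algebra)"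
  using scaleC_add_left[of b "- c" x] by (simp add: scaleC_minus_left)

lemma adj_minus: "adj (- x) = - adj (x :: 'a::cstar_algebra)"
  using adj_add[of "-x" x] by (simp add: eq_neg_iff_add_eq_0)

lemma adj_diff: "adj (x - y) = adj x - adj (y :: 'a::cstar_algebra)"
  using adj_add[of x "- y"] by (simp add: adj_minus)

lemma adj_scaleR: "adj (r *\<^sub>R x) = r *\<^sub>R adj (x :: 'a::cstar_algebra)"
  by (metis scaleC_of_real adj_scaleC complex_cnj_complex_of_real)

lemma adj_sum: "adj (sum f I) = (\<Sum>i\<in>I. adj (f i :: 'a::cstar_algebra))"
  by (induction I rule: infinite_finite_induct) (auto simp: adj_add)

lemma adj_power: "adj (x ^ n) = adj (x :: 'a::cstar_algebra) ^ n"
  by (induction n) (auto simp: adj_mult power_commutes)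

lemma bounded_linear_adj: "bounded_linear (adj :: 'a::cstar_algebra \<Rightarrow> 'a)"
  by (rule bounded_linear_intro[of _ 1]) (auto simp: adj_add adj_scaleR)

lemmas tendsto_adj = bounded_linear.tendsto[OF bounded_linear_adj]

lemma bounded_linear_scaleC: "bounded_linear (scaleC c :: 'a::cstar_algebra \<Rightarrow> 'a)"
proof (rule bounded_linear_intro[of _ "cmod c"])
  show "c *\<^sub>C (r *\<^sub>R x) = r *\<^sub>R c *\<^sub>C x" for r and x :: 'a
    by (simp add: scaleC_of_real[symmetric] scaleC_scaleC mult.commute)
qed (auto simp: scaleC_add_right norm_scaleC mult.commute)

lemma norm_power_2_self_adjoint:
  fixes x :: "'a::cstar_algebra"
  assumes "adj x = x"
  shows "norm (x ^ (2 ^ k)) = norm x ^ (2 ^ k)"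
proof (induction k)
  case (Suc k)
  have "norm (x ^ (2 ^ Suc k)) = norm (adj (x ^ (2 ^ k)) * x ^ (2 ^ k))"
    using assms by (simp add: adj_power power_mult power2_eq_square mult.commute[of 2]) 
  also have "\<dots> = (norm x ^ (2 ^ k))\<^sup>2" by (simp add: cstar_identity Suc)
  finally show ?case by (simp add: power_mult mult.commute[of 2])
qed simp

text \<open>For self-adjoint elements the norm is the spectral radius, so that a bound on the powers
  may lose a factor of linear growth.\<close>

lemma norm_le_if_power_growth:
  fixes x :: "'a::cstar_algebra"
  assumes x: "adj x = x" and r: "0 \<le> r" and C: "0 \<le> C"
    and growth: "\<And>n. 1 \<le> n \<Longrightarrow> norm (x ^ n) \<le> C * real n * r ^ n"
  shows "norm x \<le> r"
proof (rule ccontr)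
  assume "\<not> norm x \<le> r"
  then have lt: "r < norm x" by simp
  have pos: "0 < norm x" using lt r by linarith
  define t where "t = r / norm x"
  have t: "0 \<le> t" "t < 1" using lt r by (auto simp: t_def divide_simps)
  have "(\<lambda>n. real n * t ^ n) \<longlonglongrightarrow> 0"
    using t by (intro powser_times_n_limit_0) auto
  then have lim: "(\<lambda>k. C * (real (2 ^ k) * t ^ (2 ^ k))) \<longlonglongrightarrow> C * 0"
    by (intro tendsto_mult tendsto_const)
       (rule LIMSEQ_subseq_LIMSEQ[of _ _ "\<lambda>k. 2 ^ k", unfolded o_def], auto simp: strict_mono_def)
  have "1 \<le> C * (real (2 ^ k) * t ^ (2 ^ k))" for k
  proof -
    have "norm x ^ (2 ^ k) \<le> C * real (2 ^ k) * r ^ (2 ^ k)"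
      using growth[of "2 ^ k"] norm_power_2_self_adjoint[OF x, of k] by simp
    then show ?thesis using pos by (simp add: t_def power_divide divide_simps mult.assoc)
  qed
  then have "1 \<le> C * 0" by (intro LIMSEQ_le_const[OF lim]) auto
  then show False by simp
qed

text \<open>Orthogonality turns the \<open>n\<close>-th power of the sum into the sum of the
  \<open>n\<close>-th powers, whose norm is at most \<open>card I * d ^ n\<close>; passing to the
  spectral radius removes the factor \<open>card I\<close>. The triangle inequality would keep that
  factor, which is fatal when the number of steps grows as their height \<open>d\<close>
  shrinks.\<close>

lemma norm_sum_orthogonal_le:
  fixes w :: "'i \<Rightarrow> 'a::cstar_algebra"
  assumes fin: "finite I" and sa: "\<And>i. i \<in> I \<Longrightarrow> adj (w i) = w i"
    and orth: "\<And>i j. i \<in> I \<Longrightarrow> j \<in> I \<Longrightarrow> i \<noteq> j \<Longrightarrow> w i * w j = 0"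
    and le: "\<And>i. i \<in> I \<Longrightarrow> norm (w i) \<le> d" and d: "0 \<le> d"
  shows "norm (\<Sum>i\<in>I. w i) \<le> d"
proof (rule norm_le_if_power_growth[of _ _ "real (card I)"])
  show "adj (\<Sum>i\<in>I. w i) = (\<Sum>i\<in>I. w i)" using sa by (simp add: adj_sum)
  fix n :: nat assume n: "1 \<le> n"
  have "(\<Sum>i\<in>I. w i) ^ Suc m = (\<Sum>i\<in>I. w i ^ Suc m)" for m
  proof (induction m)
    case (Suc m)
    have "(\<Sum>i\<in>I. w i) ^ Suc (Suc m) = (\<Sum>i\<in>I. w i) * (\<Sum>j\<in>I. w j ^ Suc m)"
      using Suc by simp
    also have "\<dots> = (\<Sum>i\<in>I. \<Sum>j\<in>I. w i * w j ^ Suc m)" by (simp add: sum_product)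
    also have "\<dots> = (\<Sum>i\<in>I. w i ^ Suc (Suc m))"
    proof (rule sum.cong[OF refl])
      fix i assume i: "i \<in> I"
      have "w i * w j ^ Suc m = (if j = i then w i ^ Suc (Suc m) else 0)" if "j \<in> I" for j
        using orth[OF i that] by (auto simp: mult.assoc[symmetric])
      then show "(\<Sum>j\<in>I. w i * w j ^ Suc m) = w i ^ Suc (Suc m)"
        using i fin by (simp del: power_Suc)
    qed
    finally show ?case .
  qed simp
  from this[of "n - 1"] have "norm ((\<Sum>i\<in>I. w i) ^ n) = norm (\<Sum>i\<in>I. w i ^ n)" using n by simp
  also have "\<dots> \<le> (\<Sum>i\<in>I. d ^ n)"
    by (intro sum_norm_le order_trans[OF norm_power_ineq] power_mono le) auto
  also have "\<dots> = real (card I) * 1 * d ^ n" by simp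
  also have "\<dots> \<le> real (card I) * real n * d ^ n"
    using n d by (intro mult_right_mono mult_left_mono) auto
  finally show "norm ((\<Sum>i\<in>I. w i) ^ n) \<le> real (card I) * real n * d ^ n" .
qed (use d in auto)

section \<open>Complex polynomials evaluated at an element of the algebra\<close>

definition poly_eval :: "'a::cstar_algebra \<Rightarrow> complex poly \<Rightarrow> 'a" where
  "poly_eval a p = fold_coeffs (\<lambda>c y. c *\<^sub>C 1 + a * y) p 0"

lemma poly_eval_0 [simp]: "poly_eval a 0 = 0"
  by (simp add: poly_eval_def)

lemma poly_eval_pCons [simp]: "poly_eval a (pCons c p) = c *\<^sub>C 1 + a * poly_eval a p"
  by (cases "p = 0 \<and> c = 0") (auto simp: poly_eval_def)

lemma poly_eval_add: "poly_eval a (p + q) = poly_eval a p + poly_eval a q"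
  by (induction p q rule: poly_induct2) (auto simp: scaleC_add_left algebra_simps)

lemma poly_eval_smult: "poly_eval a (smult c p) = c *\<^sub>C poly_eval a p"
  by (induction p) (auto simp: scaleC_add_right scaleC_scaleC mult_scaleC_right)

lemma poly_eval_diff: "poly_eval a (p - q) = poly_eval a p - poly_eval a q"
  using poly_eval_add[of a p "smult (-1) q"] poly_eval_smult[of a "-1" q]
  by (simp add: scaleC_minus_left)

lemma poly_eval_sum: "poly_eval a (\<Sum>i\<in>I. f i) = (\<Sum>i\<in>I. poly_eval a (f i))"
  by (induction I rule: infinite_finite_induct) (auto simp: poly_eval_add)

lemma poly_eval_mult: "poly_eval a (p * q) = poly_eval a p * poly_eval a q"
  by (induction p)
     (auto simp: poly_eval_add poly_eval_smult distrib_right mult_scaleC_left mult.assoc)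

lemma poly_eval_1 [simp]: "poly_eval a 1 = 1"
  by (simp add: one_pCons)

lemma poly_eval_power: "poly_eval a (p ^ n) = poly_eval a p ^ n"
  by (induction n) (auto simp: poly_eval_mult)

lemma poly_eval_monom: "poly_eval a (monom c n) = c *\<^sub>C a ^ n"
  by (induction n) (auto simp: monom_0 monom_Suc mult_scaleC_right)

lemma poly_eval_altdef:
  assumes "degree p \<le> n"
  shows "poly_eval a p = (\<Sum>i\<le>n. coeff p i *\<^sub>C a ^ i)"
proof -
  have "poly_eval a p = poly_eval a (\<Sum>i\<le>n. monom (coeff p i) i)"
    by (simp add: poly_as_sum_of_monoms'[OF assms])
  then show ?thesis by (simp add: poly_eval_sum poly_eval_monom)
qed

text \<open>Two elements are allowed because the case \<open>b = - a\<close> is what carries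
  anticommutation relations over to spectral projections; \<open>b = a\<close> gives
  commutation.\<close>

lemma poly_eval_intertwine:
  assumes "a * w = w * b"
  shows "poly_eval a p * w = w * poly_eval b p"
proof (induction p)
  case (pCons c p)
  have "a * poly_eval a p * w = w * b * poly_eval b p"
    by (simp add: mult.assoc pCons) (simp add: mult.assoc[symmetric] assms)
  then show ?case
    by (simp add: algebra_simps mult_scaleC_left mult_scaleC_right)
qed simp

lemma poly_eval_adj:
  assumes "adj a = a"
  shows "adj (poly_eval a p) = poly_eval a (map_poly cnj p)"
proof (induction p)
  case (pCons c p)
  have "a * poly_eval a (map_poly cnj p) = poly_eval a (map_poly cnj p) * a"
    using poly_eval_intertwine[of a a a "map_poly cnj p"] by simp
  with pCons show ?case
    by (simp add: map_poly_pCons adj_add adj_scaleC adj_mult assms)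
qed simp

text \<open>A discrete Cauchy estimate: averaging \<open>P(z) / z ^ k\<close> over sufficiently many
  roots of unity returns the coefficient exactly.\<close>

lemma coeff_bound_unit_circle:
  fixes P :: "complex poly"
  assumes M: "\<And>z. cmod z = 1 \<Longrightarrow> cmod (poly P z) \<le> M"
  shows "cmod (coeff P k) \<le> M"
proof (cases "k \<le> degree P")
  case False
  then have "coeff P k = 0" by (simp add: coeff_eq_0)
  moreover have "0 \<le> M" using order_trans[OF norm_ge_zero M[of 1]] by simp
  ultimately show ?thesis by simp
next
  case k: True
  \<comment> \<open>One more root of unity than the degree, so that the exponents
    \<open>0, ..., degree P\<close> stay distinct modulo \<open>N\<close> and no other coefficient
    enters the average.\<close>
  define N where "N = Suc (degree P)"
  define w where "w = cis (2 * pi / real N)"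
  have w_pow: "w ^ i = cis (2 * pi * real i / real N)" for i
    by (simp add: w_def Complex.DeMoivre mult_ac)
  have wN: "w ^ N = 1" unfolding w_pow by (simp add: N_def)
  have cw: "cmod w = 1" by (simp add: w_def)
  have ww: "w * cnj w = 1" using cw by (simp add: complex_norm_square[symmetric])
  have "inj_on (\<lambda>i. w ^ i) {..<N}"
    using Complex.bij_betw_roots_unity[of N] unfolding bij_betw_def w_pow by (simp add: N_def)
  then have inj: "w ^ i \<noteq> w ^ k" if "i < N" "i \<noteq> k" for i
    using that k unfolding inj_on_def by (auto simp: N_def)
  have "(\<Sum>j<N. (w ^ i * cnj w ^ k) ^ j) = (if i = k then of_nat N else 0)" if i: "i < N" for i
  proof (cases "i = k")
    case True
    then show ?thesis by (simp add: power_mult_distrib[symmetric] ww)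
  next
    case False
    have "w ^ i * cnj w ^ k \<noteq> 1"
    proof
      assume "w ^ i * cnj w ^ k = 1"
      then have "w ^ i * (w * cnj w) ^ k = w ^ k" by (simp add: power_mult_distrib mult_ac)
      then show False using inj[OF i False] ww by simp
    qed
    moreover have "(w ^ i * cnj w ^ k) ^ N = 1"
      using wN by (metis complex_cnj_one complex_cnj_power mult_1 power_commuting_commutes power_mult
          power_mult_distrib power_one mult.commute)
    ultimately show ?thesis using False by (simp add: sum_gp_strict)
  qed
  note geo = this
  have "(\<Sum>j<N. cnj w ^ (k * j) * poly P (w ^ j))
      = (\<Sum>j<N. \<Sum>i<N. coeff P i * (w ^ i * cnj w ^ k) ^ j)"
    by (intro sum.cong refl)
       (simp add: poly_altdef N_def lessThan_Suc_atMost sum_distrib_left power_mult_distrib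
          power_mult[symmetric] mult_ac)
  also have "\<dots> = (\<Sum>i<N. coeff P i * (\<Sum>j<N. (w ^ i * cnj w ^ k) ^ j))"
    by (subst sum.swap) (simp add: sum_distrib_left)
  also have "\<dots> = (\<Sum>i<N. if i = k then coeff P i * of_nat N else 0)"
    using geo by (intro sum.cong) auto
  also have "\<dots> = coeff P k * of_nat N"
    using k by (subst sum.delta) (auto simp: N_def)
  finally have "real N * cmod (coeff P k) = cmod (\<Sum>j<N. cnj w ^ (k * j) * poly P (w ^ j))"
    by (simp add: norm_mult)
  also have "\<dots> \<le> (\<Sum>j<N. M)"
    by (intro sum_norm_le) (simp add: norm_mult norm_power cw M)
  finally have "real N * cmod (coeff P k) \<le> real N * M" by simp
  then show ?thesis by (simp add: N_def del: of_nat_Suc)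
qed

text \<open>The binomial series of exponent 1/2 at \<open>- y\<close>. Its coefficients have modulus
  at most 1, so \<open>norm y \<le> 1/2\<close> gives a geometric majorant.\<close>

lemma sqrt_one_minus_exists:
  fixes y :: "'a::cstar_algebra"
  assumes y: "adj y = y" and ny: "norm y \<le> 1/2"
  obtains v where "adj v = v" "v * v = 1 - y" "\<And>z. z * y = y * z \<Longrightarrow> z * v = v * z"
proof -
  define c where "c n = ((1/2::real) gchoose n)" for n
  define f where "f n = c n *\<^sub>R (- y) ^ n" for n
  have c_le: "\<bar>c n\<bar> \<le> 1" for n
  proof (induction n)
    case (Suc n)
    have "c (Suc n) = c n * ((1/2 - real n) / real (Suc n))"
      using gbinomial_absorption'[of "Suc n" "1/2::real"]
      using gbinomial_mult_1[of "1/2::real" n]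
      by (simp add: c_def field_simps)
    moreover have "\<bar>(1/2 - real n) / real (Suc n)\<bar> \<le> 1"
      by (simp add: divide_simps abs_if)
    ultimately show ?case
      using Suc mult_mono[of "\<bar>c n\<bar>" 1 "\<bar>(1/2 - real n) / real (Suc n)\<bar>" 1]
      by (simp only: abs_mult) simp
  qed (simp add: c_def)
  have nf: "norm (f n) \<le> (1/2) ^ n" for n
  proof -
    have "norm (f n) \<le> 1 * norm ((- y) ^ n)"
      unfolding f_def norm_scaleR by (intro mult_right_mono c_le) auto
    also have "\<dots> \<le> norm y ^ n" using norm_power_ineq[of "- y" n] by simp
    also have "\<dots> \<le> (1/2) ^ n" by (intro power_mono ny) auto
    finally show ?thesis .
  qed
  have sn: "summable (\<lambda>n. norm (f n))"
    by (rule summable_comparison_test'[of "\<lambda>n. (1/2::real) ^ n" 0])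
       (use nf in \<open>auto intro: summable_geometric\<close>)
  then have s: "summable f" by (rule summable_norm_cancel)
  define v where "v = suminf f"
  have sums: "f sums v" using s by (simp add: v_def summable_sums)
  have "adj (f n) = f n" for n by (simp add: f_def adj_scaleR adj_power adj_minus y)
  then have "f sums adj v" using bounded_linear.sums[OF bounded_linear_adj sums] by simp
  then have "adj v = v" using sums sums_unique2 by blast
  moreover have "v * v = 1 - y"
  proof -
    \<comment> \<open>By Vandermonde's identity the Cauchy square of the series has the coefficients
      of exponent 1/2 + 1/2 = 1, hence stops after the linear term.\<close>
    have "(\<Sum>i\<le>k. f i * f (k - i)) = (if k = 0 then 1 else if k = 1 then - y else 0)" for k
    proof -
      have "(\<Sum>i\<le>k. f i * f (k - i)) = (\<Sum>i\<le>k. (c i * c (k - i)) *\<^sub>R (- y) ^ k)"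
        by (intro sum.cong refl) (auto simp: f_def power_add[symmetric])
      also have "\<dots> = ((1/2 + 1/2::real) gchoose k) *\<^sub>R (- y) ^ k"
        by (simp only: scaleR_left.sum[symmetric] c_def gbinomial_Vandermonde[symmetric] atLeast0AtMost)
      also have "((1/2 + 1/2::real) gchoose k) = of_nat (1 choose k)"
        by (simp add: binomial_gbinomial)
      finally show ?thesis by (cases k; cases "k - 1") auto
    qed
    then have "(\<lambda>k. if k = 0 then 1 else if k = 1 then - y else 0) sums (v * v)"
      using Cauchy_product_sums[OF sn sn] by (simp add: v_def)
    moreover have "(\<lambda>k. if k = 0 then 1 else if k = 1 then - y else 0) sums
        (\<Sum>k\<in>{0,1::nat}. if k = 0 then 1 else if k = 1 then - y else 0)"
      by (rule sums_finite) auto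
    ultimately show ?thesis using sums_unique2 by fastforce
  qed
  moreover have "z * v = v * z" if z: "z * y = y * z" for z
  proof -
    have "(- y) ^ n * z = z * (- y) ^ n" for n
      by (induction n) (simp_all add: mult.assoc z, simp add: mult.assoc[symmetric] z)
    then have "z * f n = f n * z" for n by (simp add: f_def)
    moreover have "(\<lambda>n. z * f n) sums (z * v)" "(\<lambda>n. f n * z) sums (v * z)"
      by (auto intro: sums_mult sums_mult2 sums)
    ultimately show ?thesis using sums_unique2 by simp
  qed
  ultimately show thesis by (rule that)
qed

subsection \<open>Continuous functional calculus\<close>

text \<open>With \<open>b = a / K\<close> the unitary is \<open>u = b + \<i> v\<close>, where
  \<open>v\<close> is a square root of \<open>1 - b * b\<close> commuting with \<open>b\<close>; so
  \<open>b\<close> is its real part. The factor 2 in the bound on \<open>K\<close> gives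
  \<open>norm b \<le> 1/2\<close>, which puts \<open>b * b\<close> within reach of the binomial
  series.\<close>

lemma unitary_dilation:
  fixes a :: "'a::cstar_algebra"
  assumes a: "adj a = a" and K: "0 < K" "2 * norm a \<le> K"
  obtains u where "adj u * u = 1" "u * adj u = 1" "2 *\<^sub>R a = K *\<^sub>R (u + adj u)"
proof -
  define b where "b = (1 / K) *\<^sub>R a"
  have b: "adj b = b" by (simp add: b_def adj_scaleR a)
  have "norm b \<le> 1/2" using K by (simp add: b_def divide_simps)
  then have "norm (b * b) \<le> 1/2 * (1/2)"
    by (intro order_trans[OF norm_mult_ineq] mult_mono) auto
  then have "norm (b * b) \<le> 1/2" by simp
  with b obtain v where v: "adj v = v" "v * v = 1 - b * b"
    and comm: "\<And>z. z * (b * b) = b * b * z \<Longrightarrow> z * v = v * z"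
    using sqrt_one_minus_exists[of "b * b"] by (metis adj_mult)
  have bv: "b * v = v * b" by (rule comm) (simp add: mult.assoc)
  define w where "w = \<i> *\<^sub>C v"
  have ww: "w * w = - (1 - b * b)"
    by (simp only: w_def mult_scaleC_left mult_scaleC_right scaleC_scaleC v(2))
       (simp add: scaleC_minus_left)
  have bw: "b * w = w * b" by (simp add: w_def mult_scaleC_left mult_scaleC_right bv)
  define u where "u = b + w"
  have au: "adj u = b - w"
    by (simp add: u_def w_def adj_add adj_scaleC b v scaleC_minus_left)
  have "adj u * u = 1" "u * adj u = 1"
    unfolding au by (simp_all add: u_def algebra_simps ww bw)
  moreover have "2 *\<^sub>R a = K *\<^sub>R (u + adj u)"
  proof -
    have "u + adj u = 2 *\<^sub>R b" unfolding au by (simp add: u_def scaleR_2)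
    then show ?thesis using K by (simp add: b_def)
  qed
  ultimately show thesis by (rule that)
qed

text \<open>A sum of \<open>n + 1\<close> terms of norm at most \<open>M\<close>. The factor
  \<open>n + 1\<close> is a deliberate loss: it is linear in the degree, and taking powers removes
  it later.\<close>

lemma norm_poly_eval_unitary_le:
  fixes u :: "'a::cstar_algebra"
  assumes u: "adj u * u = 1" and M: "\<And>z. cmod z = 1 \<Longrightarrow> cmod (poly P z) \<le> M"
    and n: "degree P \<le> n"
  shows "norm (poly_eval u P) \<le> real (Suc n) * M"
proof -
  have "(norm u)\<^sup>2 = 1" using cstar_identity[of u] u by simp
  then have nu: "norm u = 1" using power2_eq_1_iff[of "norm u"] norm_ge_zero[of u] by auto
  have "norm (poly_eval u P) \<le> (\<Sum>i\<le>n. M)"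
    unfolding poly_eval_altdef[OF n]
  proof (rule sum_norm_le)
    fix i
    have "norm (coeff P i *\<^sub>C u ^ i) \<le> M * 1"
      unfolding norm_scaleC
    proof (rule mult_mono)
      show "cmod (coeff P i) \<le> M" by (rule coeff_bound_unit_circle[OF M])
      then show "0 \<le> M" using norm_ge_zero order_trans by blast
      show "norm (u ^ i) \<le> 1" using norm_power_ineq[of u i] nu by simp
    qed simp
    then show "norm (coeff P i *\<^sub>C u ^ i) \<le> M" by simp
  qed
  then show ?thesis by simp
qed

text \<open>Multiplying \<open>r(a) = r (K/2 (u + u\<^sup>*))\<close> by \<open>u\<^sup>n\<close>, where \<open>n\<close> is the degree of \<open>r\<close>, turns it
  into a polynomial in \<open>u\<close> whose modulus on the unit circle is that of \<open>r\<close> on \<open>[-K, K]\<close>.\<close>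

lemma norm_poly_eval_le_degree:
  fixes a :: "'a::cstar_algebra"
  assumes a: "adj a = a" and K: "0 < K" "2 * norm a \<le> K"
    and M: "\<And>t. \<bar>t\<bar> \<le> K \<Longrightarrow> cmod (poly r (of_real t)) \<le> M" and n: "degree r \<le> n"
  shows "norm (poly_eval a r) \<le> real (Suc (2 * n)) * M"
proof -
  obtain u where u: "adj u * u = 1" "u * adj u = 1" and ua: "2 *\<^sub>R a = K *\<^sub>R (u + adj u)"
    using unitary_dilation[OF a K] .
  \<comment> \<open>This is \<open>z ^ n * r (K/2 * (z + 1/z))\<close> without negative powers:
    \<open>[:1, 0, 1:]\<close> is \<open>z * (z + 1/z)\<close>, and the monomial supplies the
    remaining \<open>n - i\<close> factors \<open>z\<close>.\<close>
  define R where
    "R = (\<Sum>i\<le>n. smult (coeff r i * (K / 2) ^ i) ([:1, 0, 1:] ^ i * monom 1 (n - i)))"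
  have a_eq: "a = (K / 2) *\<^sub>R (u + adj u)"
  proof -
    have "a = (1 / 2) *\<^sub>R (2 *\<^sub>R a)" by simp
    also have "\<dots> = (K / 2) *\<^sub>R (u + adj u)" unfolding ua by simp
    finally show ?thesis .
  qed
  have ua_comm: "u * a = a * u" using u by (simp add: a_eq algebra_simps)
  have quad: "(complex_of_real (K / 2) ^ i) *\<^sub>C poly_eval u ([:1, 0, 1:] ^ i) = u ^ i * a ^ i" for i
  proof -
    have "poly_eval u [:1, 0, 1:] = (u + adj u) * u"
      using u by (simp add: algebra_simps)
    also have "complex_of_real (K / 2) *\<^sub>C \<dots> = a * u"
      unfolding scaleC_of_real by (simp only: a_eq mult_scaleR_left)
    also have "\<dots> = u * a" by (simp only: ua_comm)
    finally have q: "complex_of_real (K / 2) *\<^sub>C poly_eval u [:1, 0, 1:] = u * a" .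
    have pw: "(c *\<^sub>C x) ^ i = c ^ i *\<^sub>C x ^ i" for c and x :: 'a
      by (induction i) (auto simp: mult_scaleC_left mult_scaleC_right scaleC_scaleC mult.commute)
    have "(u * a) ^ i = u ^ i * a ^ i"
    proof (induction i)
      case (Suc i)
      have "u ^ i * a = a * u ^ i" using ua_comm by (rule power_commuting_commutes)
      then have "u * a * (u ^ i * a ^ i) = u * u ^ i * (a * a ^ i)"
        by (metis mult.assoc)
      with Suc show ?case by simp
    qed simp
    then show ?thesis unfolding poly_eval_power pw[symmetric] q .
  qed
  have R: "poly_eval u R = u ^ n * poly_eval a r"
  proof -
    have "poly_eval u R = (\<Sum>i\<le>n. coeff r i *\<^sub>C ((complex_of_real (K / 2) ^ i) *\<^sub>C poly_eval u ([:1, 0, 1:] ^ i)) * u ^ (n - i))"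
      by (simp add: R_def poly_eval_sum poly_eval_smult poly_eval_mult poly_eval_monom
          scaleC_scaleC mult_scaleC_left)
    also have "\<dots> = (\<Sum>i\<le>n. coeff r i *\<^sub>C (u ^ n * a ^ i))"
    proof (rule sum.cong[OF refl])
      fix i assume "i \<in> {..n}"
      have "a ^ i * u ^ (n - i) = u ^ (n - i) * a ^ i"
        using ua_comm by (metis power_commuting_commutes)
      then have "u ^ i * a ^ i * u ^ (n - i) = u ^ (i + (n - i)) * a ^ i"
        by (simp add: power_add mult.assoc)
      also have "i + (n - i) = n" using \<open>i \<in> {..n}\<close> by simp
      finally show "coeff r i *\<^sub>C ((complex_of_real (K / 2) ^ i) *\<^sub>C poly_eval u ([:1, 0, 1:] ^ i)) * u ^ (n - i)
          = coeff r i *\<^sub>C (u ^ n * a ^ i)"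
        unfolding quad by (simp add: mult_scaleC_left)
    qed
    also have "\<dots> = u ^ n * poly_eval a r"
      by (simp add: poly_eval_altdef[OF n] sum_distrib_left mult_scaleC_right)
    finally show ?thesis .
  qed
  have "degree R \<le> 2 * n"
    unfolding R_def
  proof (rule degree_sum_le)
    fix i assume "i \<in> {..n}"
    have "degree ([:1, 0, 1:] ^ i * monom 1 (n - i) :: complex poly) \<le> 2 * i + (n - i)"
      by (intro order_trans[OF degree_mult_le] add_mono order_trans[OF degree_power_le] degree_monom_le) auto
    then show "degree (smult (coeff r i * (K / 2) ^ i) ([:1, 0, 1:] ^ i * monom 1 (n - i))) \<le> 2 * n"
      using \<open>i \<in> {..n}\<close> by (intro order_trans[OF degree_smult_le]) simp
  qed simp
  moreover have "cmod (poly R z) \<le> M" if z: "cmod z = 1" for z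
  proof -
    \<comment> \<open>On the unit circle \<open>z + 1/z\<close> is \<open>2 * Re z\<close>, so the
      argument of \<open>r\<close> becomes \<open>K * Re z\<close>, a point of
      \<open>[-K, K]\<close>.\<close>
    have zz: "1 + z * z = 2 * of_real (Re z) * z"
    proof -
      have "1 = z * cnj z" using z by (simp add: complex_norm_square[symmetric])
      then have "1 + z * z = (z + cnj z) * z" by (simp add: algebra_simps)
      then show ?thesis by (simp add: complex_add_cnj)
    qed
    have "poly R z = (\<Sum>i\<le>n. coeff r i * (of_real (K * Re z) ^ i * z ^ n))"
      unfolding R_def poly_sum
    proof (rule sum.cong[OF refl])
      fix i assume "i \<in> {..n}"
      then have "z ^ i * z ^ (n - i) = z ^ n" by (simp add: power_add[symmetric])
      then show "poly (smult (coeff r i * (K / 2) ^ i) ([:1, 0, 1:] ^ i * monom 1 (n - i))) z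
          = coeff r i * (of_real (K * Re z) ^ i * z ^ n)"
        by (simp add: zz poly_power poly_monom power_mult_distrib power_divide mult.assoc)
    qed
    also have "\<dots> = z ^ n * poly r (of_real (K * Re z))"
      by (subst (2) poly_as_sum_of_monoms'[OF n, symmetric])
         (simp add: poly_sum poly_monom sum_distrib_left mult_ac)
    finally have "cmod (poly R z) = cmod (poly r (of_real (K * Re z)))"
      by (simp add: norm_mult norm_power z)
    moreover have "\<bar>K * Re z\<bar> \<le> K"
      using K abs_Re_le_cmod[of z] z by (simp add: abs_mult)
    ultimately show ?thesis using M by metis
  qed
  ultimately have "norm (poly_eval u R) \<le> real (Suc (2 * n)) * M"
    by (intro norm_poly_eval_unitary_le[OF u(1)])
  moreover have "norm (poly_eval u R) = norm (poly_eval a r)"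
  proof -
    have "adj u ^ n * u ^ n = 1"
    proof (induction n)
      case (Suc n)
      have "adj u ^ Suc n * u ^ Suc n = adj u ^ n * (adj u * u) * u ^ n"
        by (simp only: power_Suc2 power_Suc mult.assoc) (simp add: power_commutes mult.assoc)
      then show ?case using u Suc by simp
    qed simp
    then have "adj (u ^ n * x) * (u ^ n * x) = adj x * x" for x
      by (simp add: adj_mult adj_power mult.assoc) (simp add: mult.assoc[symmetric])
    then have "(norm (u ^ n * x))\<^sup>2 = (norm x)\<^sup>2" for x
      by (metis cstar_identity)
    then show ?thesis by (simp add: R)
  qed
  ultimately show ?thesis by simp
qed

text \<open>The degree of \<open>r ^ n\<close> is linear in \<open>n\<close>, so the
  degree-dependent bound, applied to all powers of \<open>r\<close>, is of the form that
  \<open>norm_le_if_power_growth\<close> accepts. Taking \<open>r\<close> to be \<open>p\<close>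
  times its conjugate makes \<open>r(a)\<close> self-adjoint, and the C*-identity brings the bound
  back to \<open>p\<close>.\<close>

lemma norm_poly_eval_le:
  fixes a :: "'a::cstar_algebra"
  assumes a: "adj a = a" and K: "0 < K" "2 * norm a \<le> K"
    and M: "\<And>t. \<bar>t\<bar> \<le> K \<Longrightarrow> cmod (poly p (of_real t)) \<le> M"
  shows "norm (poly_eval a p) \<le> M"
proof -
  have M0: "0 \<le> M" using K order_trans[OF norm_ge_zero M[of 0]] by simp
  define r where "r = map_poly cnj p * p"
  have r: "poly_eval a r = adj (poly_eval a p) * poly_eval a p"
    by (simp add: r_def poly_eval_mult poly_eval_adj[OF a])
  have "norm (poly_eval a r) \<le> M\<^sup>2"
  proof (rule norm_le_if_power_growth[of _ _ "real (2 * degree r + 1)"])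
    show "adj (poly_eval a r) = poly_eval a r" by (simp add: r adj_mult adj_adj)
    fix n :: nat assume n: "1 \<le> n"
    have "norm (poly_eval a (r ^ n)) \<le> real (Suc (2 * (degree r * n))) * (M\<^sup>2) ^ n"
    proof (rule norm_poly_eval_le_degree[OF a K])
      fix t :: real assume t: "\<bar>t\<bar> \<le> K"
      have "cmod (poly r (of_real t)) = (cmod (poly p (of_real t)))\<^sup>2"
        by (simp add: r_def norm_mult power2_eq_square)
      also have "\<dots> \<le> M\<^sup>2" by (intro power_mono M t) simp
      finally show "cmod (poly (r ^ n) (of_real t)) \<le> (M\<^sup>2) ^ n"
        by (simp add: poly_power norm_power power_mono)
    qed (simp add: degree_power_le)
    also have "\<dots> \<le> real (2 * degree r + 1) * real n * (M\<^sup>2) ^ n"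
    proof (rule mult_right_mono)
      have "Suc (2 * (degree r * n)) \<le> (2 * degree r + 1) * n" using n by simp
      then show "real (Suc (2 * (degree r * n))) \<le> real (2 * degree r + 1) * real n"
        by (simp only: of_nat_mult[symmetric] of_nat_le_iff)
    qed (use M0 in simp)
    finally show "norm (poly_eval a r ^ n) \<le> real (2 * degree r + 1) * real n * (M\<^sup>2) ^ n"
      by (simp only: poly_eval_power)
  qed simp_all
  then have "(norm (poly_eval a p))\<^sup>2 \<le> M\<^sup>2" by (simp add: r cstar_identity)
  then show ?thesis using M0 by (rule power2_le_imp_le)
qed

text \<open>A relation comes before the function \<open>fcalc\<close>: differences and products are
  verified on arbitrary approximating polynomials, and uniqueness of the limit then transfers them
  to \<open>fcalc\<close>.\<close>

definition fcalc_limit :: "real \<Rightarrow> 'a::cstar_algebra \<Rightarrow> (real \<Rightarrow> real) \<Rightarrow> 'a \<Rightarrow> bool" where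
  "fcalc_limit K a f x \<longleftrightarrow> (\<exists>P. uniform_limit {-K..K} (\<lambda>n t. poly (P n) (complex_of_real t))
      (\<lambda>t. complex_of_real (f t)) sequentially \<and> (\<lambda>n. poly_eval a (P n)) \<longlonglongrightarrow> x)"

text \<open>\<open>f(a)\<close> depends on \<open>f\<close> only through its values on the spectrum of \<open>a\<close>, but the interval
  \<open>[-K, K]\<close> on which \<open>f\<close> is approximated is kept as a parameter in order to avoid spectra.\<close>

definition fcalc :: "real \<Rightarrow> 'a::cstar_algebra \<Rightarrow> (real \<Rightarrow> real) \<Rightarrow> 'a" where
  "fcalc K a f = (THE x. fcalc_limit K a f x)"

lemma fcalc_limit_norm_le:
  fixes a :: "'a::cstar_algebra"
  assumes a: "adj a = a" and K: "0 < K" "2 * norm a \<le> K"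
    and x: "fcalc_limit K a f x" and M: "\<And>t. \<bar>t\<bar> \<le> K \<Longrightarrow> \<bar>f t\<bar> \<le> M"
  shows "norm x \<le> M"
proof (rule field_le_epsilon)
  fix \<epsilon> :: real assume \<epsilon>: "0 < \<epsilon>"
  from x obtain P where P: "uniform_limit {-K..K} (\<lambda>n t. poly (P n) (complex_of_real t))
      (\<lambda>t. complex_of_real (f t)) sequentially" and lim: "(\<lambda>n. poly_eval a (P n)) \<longlonglongrightarrow> x"
    by (auto simp: fcalc_limit_def)
  have "\<forall>\<^sub>F n in sequentially. norm (poly_eval a (P n)) \<le> M + \<epsilon>"
    using uniform_limitD[OF P \<epsilon>]
  proof eventually_elim
    case (elim n)
    show ?case
    proof (rule norm_poly_eval_le[OF a K])
      fix t :: real assume t: "\<bar>t\<bar> \<le> K"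
      then have "t \<in> {-K..K}" by auto
      with elim have "dist (poly (P n) (of_real t)) (complex_of_real (f t)) < \<epsilon>" by blast
      moreover have "cmod (complex_of_real (f t)) \<le> M" using M[OF t] by simp
      ultimately show "cmod (poly (P n) (of_real t)) \<le> M + \<epsilon>"
        by (metis add_mono dist_norm less_imp_le norm_triangle_sub order_trans)
    qed
  qed
  then show "norm x \<le> M + \<epsilon>"
    using tendsto_upperbound[OF tendsto_norm[OF lim]] by simp
qed

lemma fcalc_limit_diff:
  assumes "fcalc_limit K a f x" "fcalc_limit K a g y"
  shows "fcalc_limit K a (\<lambda>t. f t - g t) (x - y)"
proof -
  from assms obtain P Q where
    "uniform_limit {-K..K} (\<lambda>n t. poly (P n) (complex_of_real t)) (\<lambda>t. complex_of_real (f t)) sequentially"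
    "uniform_limit {-K..K} (\<lambda>n t. poly (Q n) (complex_of_real t)) (\<lambda>t. complex_of_real (g t)) sequentially"
    and "(\<lambda>n. poly_eval a (P n)) \<longlonglongrightarrow> x" "(\<lambda>n. poly_eval a (Q n)) \<longlonglongrightarrow> y"
    by (auto simp: fcalc_limit_def)
  then show ?thesis
    unfolding fcalc_limit_def
    by (intro exI[of _ "\<lambda>n. P n - Q n"])
       (auto simp: poly_eval_diff intro!: tendsto_diff uniform_limit_minus)
qed

lemma fcalc_limit_mult:
  assumes "fcalc_limit K a f x" "fcalc_limit K a g y"
    and "continuous_on UNIV f" "continuous_on UNIV g"
  shows "fcalc_limit K a (\<lambda>t. f t * g t) (x * y)"
proof -
  have bdd: "bounded ((\<lambda>t. complex_of_real (h t)) ` {-K..K})" if "continuous_on UNIV h" for h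
    using that by (intro compact_imp_bounded compact_continuous_image continuous_intros)
                  (auto intro: continuous_on_subset)
  from assms(1,2) obtain P Q where
    "uniform_limit {-K..K} (\<lambda>n t. poly (P n) (complex_of_real t)) (\<lambda>t. complex_of_real (f t)) sequentially"
    "uniform_limit {-K..K} (\<lambda>n t. poly (Q n) (complex_of_real t)) (\<lambda>t. complex_of_real (g t)) sequentially"
    and "(\<lambda>n. poly_eval a (P n)) \<longlonglongrightarrow> x" "(\<lambda>n. poly_eval a (Q n)) \<longlonglongrightarrow> y"
    by (auto simp: fcalc_limit_def)
  then show ?thesis
    unfolding fcalc_limit_def
    by (intro exI[of _ "\<lambda>n. P n * Q n"])
       (auto simp: poly_eval_mult intro!: tendsto_mult uniform_lim_mult bdd assms(3,4))
qed

lemma fcalc_limit_unique: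
  fixes a :: "'a::cstar_algebra"
  assumes a: "adj a = a" and K: "0 < K" "2 * norm a \<le> K"
    and "fcalc_limit K a f x" "fcalc_limit K a f y"
  shows "x = y"
proof -
  have "norm (x - y) \<le> 0"
    by (rule fcalc_limit_norm_le[OF a K fcalc_limit_diff[OF assms(4,5)]]) simp
  then show ?thesis by simp
qed

text \<open>Weierstrass approximants of \<open>f\<close> are uniformly Cauchy on
  \<open>[-K, K]\<close>; \<open>norm_poly_eval_le\<close> turns this into a Cauchy sequence in the
  algebra.\<close>

lemma fcalc_limit_exists:
  fixes a :: "'a::cstar_algebra"
  assumes a: "adj a = a" and K: "0 < K" "2 * norm a \<le> K" and f: "continuous_on UNIV f"
  shows "\<exists>x. fcalc_limit K a f x"
proof -
  have "\<exists>p. \<forall>t\<in>{-K..K}. cmod (poly p (complex_of_real t) - complex_of_real (f t)) < 1 / real (Suc n)" for n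
  proof -
    have "compact {-K..K}" "continuous_on {-K..K} f" "0 < 1 / real (Suc n)"
      using f by (auto intro: continuous_on_subset)
    then obtain g where "real_polynomial_function g"
      and g: "\<And>t. t \<in> {-K..K} \<Longrightarrow> \<bar>f t - g t\<bar> < 1 / real (Suc n)"
      by (rule Stone_Weierstrass_real_polynomial_function) blast
    then obtain c m where gc: "g = (\<lambda>t. \<Sum>i\<le>m. c i * t ^ i)"
      using real_polynomial_function_iff_sum by blast
    define p where "p = (\<Sum>i\<le>m. monom (complex_of_real (c i)) i)"
    have pg: "poly p (complex_of_real t) = complex_of_real (g t)" for t
      by (simp add: p_def gc poly_sum poly_monom)
    have "cmod (poly p (complex_of_real t) - complex_of_real (f t)) < 1 / real (Suc n)"
      if "t \<in> {-K..K}" for t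
      using g[OF that] unfolding pg of_real_diff[symmetric] norm_of_real
      by (simp add: abs_minus_commute)
    then show ?thesis by blast
  qed
  then obtain P where P: "\<And>n t. t \<in> {-K..K} \<Longrightarrow>
      cmod (poly (P n) (complex_of_real t) - complex_of_real (f t)) < 1 / real (Suc n)"
    by metis
  have lim: "uniform_limit {-K..K} (\<lambda>n t. poly (P n) (complex_of_real t))
      (\<lambda>t. complex_of_real (f t)) sequentially"
  proof (rule uniform_limitI)
    fix \<epsilon> :: real assume "0 < \<epsilon>"
    then have "\<forall>\<^sub>F n in sequentially. 1 / real (Suc n) < \<epsilon>"
      by (intro order_tendstoD(2)[OF LIMSEQ_Suc[OF lim_1_over_n]])
    then show "\<forall>\<^sub>F n in sequentially. \<forall>t\<in>{-K..K}. dist (poly (P n) (complex_of_real t)) (complex_of_real (f t)) < \<epsilon>"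
    proof eventually_elim
      case (elim n)
      then show ?case using less_trans[OF P elim] by (simp add: dist_norm)
    qed
  qed
  have "Cauchy (\<lambda>n. poly_eval a (P n))"
  proof (rule metric_CauchyI)
    fix \<epsilon> :: real assume \<epsilon>: "0 < \<epsilon>"
    then have "0 < \<epsilon> / 4" by simp
    from uniform_limitD[OF lim this] obtain N where
      N: "\<And>n t. n \<ge> N \<Longrightarrow> t \<in> {-K..K} \<Longrightarrow>
        dist (poly (P n) (complex_of_real t)) (complex_of_real (f t)) < \<epsilon> / 4"
      unfolding eventually_sequentially by blast
    have "dist (poly_eval a (P m)) (poly_eval a (P n)) < \<epsilon>" if "m \<ge> N" "n \<ge> N" for m n
    proof -
      have "norm (poly_eval a (P m - P n)) \<le> \<epsilon> / 2"
      proof (rule norm_poly_eval_le[OF a K])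
        fix t :: real assume "\<bar>t\<bar> \<le> K"
        then have "t \<in> {-K..K}" by auto
        with that have "dist (poly (P m) (complex_of_real t)) (complex_of_real (f t)) < \<epsilon> / 4"
          "dist (poly (P n) (complex_of_real t)) (complex_of_real (f t)) < \<epsilon> / 4"
          by (blast intro: N)+
        from dist_triangle_less_add[OF this]
        show "cmod (poly (P m - P n) (of_real t)) \<le> \<epsilon> / 2" by (simp add: dist_norm)
      qed
      then show ?thesis using \<epsilon> by (simp add: dist_norm poly_eval_diff)
    qed
    then show "\<exists>N. \<forall>m\<ge>N. \<forall>n\<ge>N. dist (poly_eval a (P m)) (poly_eval a (P n)) < \<epsilon>" by blast
  qed
  then obtain x where "(\<lambda>n. poly_eval a (P n)) \<longlonglongrightarrow> x"
    using convergent_eq_Cauchy[of "\<lambda>n. poly_eval a (P n)"] by blast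
  with lim show ?thesis unfolding fcalc_limit_def by blast
qed

lemma fcalc_limit_fcalc:
  fixes a :: "'a::cstar_algebra"
  assumes "adj a = a" "0 < K" "2 * norm a \<le> K" "continuous_on UNIV f"
  shows "fcalc_limit K a f (fcalc K a f)"
  unfolding fcalc_def
proof (rule theI')
  show "\<exists>!x. fcalc_limit K a f x"
    using fcalc_limit_exists[OF assms] fcalc_limit_unique[OF assms(1-3), of f] by (rule ex_ex1I)
qed

lemma fcalc_eqI:
  fixes a :: "'a::cstar_algebra"
  assumes "adj a = a" "0 < K" "2 * norm a \<le> K" "fcalc_limit K a f x"
  shows "fcalc K a f = x"
  unfolding fcalc_def
  by (rule the_equality) (fact assms(4), rule fcalc_limit_unique[OF assms(1-3) _ assms(4)])

lemma fcalc_limit_cong: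
  assumes "\<And>t. \<bar>t\<bar> \<le> K \<Longrightarrow> f t = g t"
  shows "fcalc_limit K a f x = fcalc_limit K a g x"
proof -
  have "uniform_limit {-K..K} F (\<lambda>t. complex_of_real (f t)) sequentially
      = uniform_limit {-K..K} F (\<lambda>t. complex_of_real (g t)) sequentially" for F :: "nat \<Rightarrow> _"
    using assms by (intro uniform_limit_cong') (auto simp: abs_le_iff)
  then show ?thesis by (simp add: fcalc_limit_def)
qed

lemma fcalc_cong:
  assumes "\<And>t. \<bar>t\<bar> \<le> K \<Longrightarrow> f t = g t"
  shows "fcalc K a f = fcalc K a g"
proof -
  have "fcalc_limit K a f = fcalc_limit K a g"
    using assms by (intro ext fcalc_limit_cong)
  then show ?thesis by (simp add: fcalc_def)
qed

lemma fcalc_limit_poly: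
  "(\<And>t. poly p (complex_of_real t) = complex_of_real (f t)) \<Longrightarrow> fcalc_limit K a f (poly_eval a p)"
  unfolding fcalc_limit_def by (intro exI[of _ "\<lambda>n. p"]) (auto intro: uniform_limit_const)

lemma fcalc_limit_intertwine:
  assumes ab: "a * w = w * b" and x: "fcalc_limit K a f x" and y: "fcalc_limit K b f y"
    and a: "adj a = a" "0 < K" "2 * norm a \<le> K" and b: "adj b = b" "2 * norm b \<le> K"
  shows "x * w = w * y"
proof -
  from x obtain P where P: "uniform_limit {-K..K} (\<lambda>n t. poly (P n) (complex_of_real t))
      (\<lambda>t. complex_of_real (f t)) sequentially" and limx: "(\<lambda>n. poly_eval a (P n)) \<longlonglongrightarrow> x"
    by (auto simp: fcalc_limit_def)
  from y obtain Q where Q: "uniform_limit {-K..K} (\<lambda>n t. poly (Q n) (complex_of_real t))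
      (\<lambda>t. complex_of_real (f t)) sequentially" and limy: "(\<lambda>n. poly_eval b (Q n)) \<longlonglongrightarrow> y"
    by (auto simp: fcalc_limit_def)
  \<comment> \<open>The approximants \<open>P\<close> for \<open>a\<close> and \<open>Q\<close> for
    \<open>b\<close> may differ, but \<open>P n - Q n\<close> tends to 0 uniformly, so
    \<open>P\<close> serves both elements and can be intertwined term by term.\<close>
  have "(\<lambda>n. poly_eval b (P n - Q n)) \<longlonglongrightarrow> 0"
  proof (rule metric_LIMSEQ_I)
    fix \<epsilon> :: real assume \<epsilon>: "0 < \<epsilon>"
    then have "0 < \<epsilon> / 4" by simp
    from uniform_limitD[OF P this] uniform_limitD[OF Q this]
    have "\<forall>\<^sub>F n in sequentially. norm (poly_eval b (P n - Q n)) \<le> \<epsilon> / 2"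
    proof eventually_elim
      case (elim n)
      show ?case
      proof (rule norm_poly_eval_le[OF b(1) a(2) b(2)])
        fix t :: real assume "\<bar>t\<bar> \<le> K"
        then have "t \<in> {-K..K}" by auto
        with elim \<epsilon> have "dist (poly (P n) (complex_of_real t)) (complex_of_real (f t)) < \<epsilon> / 4"
          "dist (poly (Q n) (complex_of_real t)) (complex_of_real (f t)) < \<epsilon> / 4"
          by auto
        from dist_triangle_less_add[OF this]
        show "cmod (poly (P n - Q n) (of_real t)) \<le> \<epsilon> / 2" by (simp add: dist_norm)
      qed
    qed
    then show "\<exists>N. \<forall>n\<ge>N. dist (poly_eval b (P n - Q n)) 0 < \<epsilon>"
      using \<epsilon> unfolding eventually_sequentially by (force simp: dist_norm)
  qed
  from tendsto_add[OF this limy] have "(\<lambda>n. poly_eval b (P n)) \<longlonglongrightarrow> y"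
    by (simp add: poly_eval_diff)
  then have "(\<lambda>n. w * poly_eval b (P n)) \<longlonglongrightarrow> w * y" by (intro tendsto_intros)
  moreover have "(\<lambda>n. poly_eval a (P n) * w) \<longlonglongrightarrow> x * w" using limx by (intro tendsto_intros)
  ultimately show ?thesis
    unfolding poly_eval_intertwine[OF ab] using LIMSEQ_unique by blast
qed

definition fcalc_dom :: "real \<Rightarrow> 'a::cstar_algebra \<Rightarrow> bool" where
  "fcalc_dom K a \<longleftrightarrow> adj a = a \<and> 0 < K \<and> 2 * norm a \<le> K"

lemma fcalc_dom_uminus: "fcalc_dom K a \<Longrightarrow> fcalc_dom K (- a)"
  by (simp add: fcalc_dom_def adj_minus)

lemma
  assumes "fcalc_dom K a"
  shows fcalc_dom_adj: "adj a = a"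
    and fcalc_dom_limit: "continuous_on UNIV f \<Longrightarrow> fcalc_limit K a f (fcalc K a f)"
    and fcalc_dom_eqI: "fcalc_limit K a f x \<Longrightarrow> fcalc K a f = x"
  using assms fcalc_limit_fcalc fcalc_eqI by (auto simp: fcalc_dom_def)

lemma fcalc_diff:
  assumes "fcalc_dom K a" "continuous_on UNIV f" "continuous_on UNIV g"
  shows "fcalc K a (\<lambda>t. f t - g t) = fcalc K a f - fcalc K a g"
  by (intro fcalc_dom_eqI fcalc_limit_diff fcalc_dom_limit assms)

lemma fcalc_mult:
  assumes "fcalc_dom K a" "continuous_on UNIV f" "continuous_on UNIV g"
  shows "fcalc K a (\<lambda>t. f t * g t) = fcalc K a f * fcalc K a g"
  by (intro fcalc_dom_eqI fcalc_limit_mult fcalc_dom_limit assms)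

lemma norm_fcalc_le:
  assumes "fcalc_dom K a" "continuous_on UNIV f" "\<And>t. \<bar>t\<bar> \<le> K \<Longrightarrow> \<bar>f t\<bar> \<le> M"
  shows "norm (fcalc K a f) \<le> M"
  using fcalc_limit_norm_le[OF _ _ _ fcalc_dom_limit[OF assms(1,2)] assms(3)] assms(1)
  by (simp add: fcalc_dom_def)

lemma fcalc_id: "fcalc_dom K a \<Longrightarrow> fcalc K a (\<lambda>t. t) = a"
  using fcalc_dom_eqI[OF _ fcalc_limit_poly[of "[:0, 1:]" "\<lambda>t. t"]] by simp

lemma fcalc_const: "fcalc_dom K a \<Longrightarrow> fcalc K a (\<lambda>t. r) = r *\<^sub>R 1"
  using fcalc_dom_eqI[OF _ fcalc_limit_poly[of "[:complex_of_real r:]" "\<lambda>t. r"]]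
  by (simp add: scaleC_of_real)

lemma adj_fcalc:
  assumes "fcalc_dom K a" "continuous_on UNIV f"
  shows "adj (fcalc K a f) = fcalc K a f"
proof -
  obtain P where "uniform_limit {-K..K} (\<lambda>n t. poly (P n) (complex_of_real t))
      (\<lambda>t. complex_of_real (f t)) sequentially" and lim: "(\<lambda>n. poly_eval a (P n)) \<longlonglongrightarrow> fcalc K a f"
    using fcalc_dom_limit[OF assms] by (auto simp: fcalc_limit_def)
  from bounded_linear.uniform_limit[OF bounded_linear_cnj this(1)] tendsto_adj[OF lim]
  have "fcalc_limit K a f (adj (fcalc K a f))"
    unfolding fcalc_limit_def
    by (intro exI[of _ "\<lambda>n. map_poly cnj (P n)"]) (simp add: poly_eval_adj fcalc_dom_adj[OF assms(1)])
  then show ?thesis by (rule fcalc_dom_eqI[OF assms(1), symmetric])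
qed

lemma poly_eval_pcompose: "poly_eval a (pcompose p q) = poly_eval (poly_eval a q) p"
  by (induction p) (auto simp: pcompose_pCons poly_eval_add poly_eval_mult)

lemma fcalc_uminus:
  assumes "fcalc_dom K a" "continuous_on UNIV f"
  shows "fcalc K (- a) f = fcalc K a (\<lambda>t. f (- t))"
proof -
  obtain P where P: "uniform_limit {-K..K} (\<lambda>n t. poly (P n) (complex_of_real t))
      (\<lambda>t. complex_of_real (f t)) sequentially"
    and lim: "(\<lambda>n. poly_eval (- a) (P n)) \<longlonglongrightarrow> fcalc K (- a) f"
    using fcalc_dom_limit[OF fcalc_dom_uminus[OF assms(1)] assms(2)] by (auto simp: fcalc_limit_def)
  have "uniform_limit {-K..K} (\<lambda>n t. poly (pcompose (P n) [:0, -1:]) (complex_of_real t))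
      (\<lambda>t. complex_of_real (f (- t))) sequentially"
  proof (rule uniform_limitI)
    fix e :: real assume "0 < e"
    from uniform_limitD[OF P this]
    show "\<forall>\<^sub>F n in sequentially. \<forall>t\<in>{-K..K}.
        dist (poly (pcompose (P n) [:0, -1:]) (complex_of_real t)) (complex_of_real (f (- t))) < e"
    proof eventually_elim
      case (elim n)
      show ?case
      proof
        fix t assume "t \<in> {-K..K}"
        then have "- t \<in> {-K..K}" by auto
        with elim have "dist (poly (P n) (complex_of_real (- t))) (complex_of_real (f (- t))) < e"
          by blast
        then show "dist (poly (pcompose (P n) [:0, -1:]) (complex_of_real t)) (complex_of_real (f (- t))) < e"
          by (simp add: poly_pcompose)
      qed
    qed
  qed
  moreover have "(\<lambda>n. poly_eval a (pcompose (P n) [:0, -1:])) \<longlonglongrightarrow> fcalc K (- a) f"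
    using lim by (simp add: poly_eval_pcompose scaleC_minus_left)
  ultimately have "fcalc_limit K a (\<lambda>t. f (- t)) (fcalc K (- a) f)"
    unfolding fcalc_limit_def by (intro exI[of _ "\<lambda>n. pcompose (P n) [:0, -1:]"] conjI)
  then show ?thesis by (rule fcalc_dom_eqI[OF assms(1), symmetric])
qed

lemma fcalc_intertwine:
  assumes "fcalc_dom K a" "fcalc_dom K b" "continuous_on UNIV f" "a * w = w * b"
  shows "fcalc K a f * w = w * fcalc K b f"
  using fcalc_limit_intertwine[OF assms(4) fcalc_dom_limit[OF assms(1,3)] fcalc_dom_limit[OF assms(2,3)]]
    assms(1,2) by (simp add: fcalc_dom_def)

text \<open>Left multiplication by \<open>a\<close> has \<open>w\<close> as an eigenvector, so a
  polynomial in \<open>a\<close> acts on \<open>w\<close> by its value at \<open>\<beta>\<close>;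
  the bound on \<open>\<beta>\<close> places it where the approximation converges.\<close>

lemma fcalc_eigen:
  assumes "fcalc_dom K a" "continuous_on UNIV f" and aw: "a * w = \<beta> *\<^sub>R w" and \<beta>: "\<bar>\<beta>\<bar> \<le> K"
  shows "fcalc K a f * w = f \<beta> *\<^sub>R w"
proof -
  obtain P where P: "uniform_limit {-K..K} (\<lambda>n t. poly (P n) (complex_of_real t))
      (\<lambda>t. complex_of_real (f t)) sequentially" and lim: "(\<lambda>n. poly_eval a (P n)) \<longlonglongrightarrow> fcalc K a f"
    using fcalc_dom_limit[OF assms(1,2)] by (auto simp: fcalc_limit_def)
  have ev: "poly_eval a p * w = poly p (complex_of_real \<beta>) *\<^sub>C w" for p
  proof (induction p)
    case (pCons c p)
    have "a * poly_eval a p * w = poly p (complex_of_real \<beta>) *\<^sub>C (a * w)"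
      by (simp add: mult.assoc pCons mult_scaleC_right)
    then show ?case
      by (simp add: distrib_right mult_scaleC_left aw scaleC_add_left scaleC_of_real[symmetric]
          scaleC_scaleC mult.commute)
  qed simp
  have "(\<lambda>n. poly (P n) (complex_of_real \<beta>)) \<longlonglongrightarrow> complex_of_real (f \<beta>)"
    using \<beta> by (intro tendsto_uniform_limitI[OF P]) auto
  then have "(\<lambda>n. (poly (P n) (complex_of_real \<beta>) - complex_of_real (f \<beta>)) *\<^sub>C w) \<longlonglongrightarrow> 0"
    by (intro tendsto_norm_zero_cancel[of "\<lambda>n. _ n *\<^sub>C w"])
       (simp add: norm_scaleC tendsto_mult_left_zero tendsto_norm_zero LIM_zero_iff)
  from tendsto_add[OF this tendsto_const[of "f \<beta> *\<^sub>R w"]]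
  have "(\<lambda>n. poly (P n) (complex_of_real \<beta>) *\<^sub>C w) \<longlonglongrightarrow> f \<beta> *\<^sub>R w"
    by (simp add: scaleC_of_real[symmetric] scaleC_add_left[symmetric])
  moreover have "(\<lambda>n. poly_eval a (P n) * w) \<longlonglongrightarrow> fcalc K a f * w"
    using lim by (intro tendsto_intros)
  ultimately show ?thesis unfolding ev using LIMSEQ_unique by blast
qed

section \<open>Membership in AW*-subalgebras\<close>

lemma aw_star_subalgebra_mem:
  fixes B :: "'a::aw_star_algebra set"
  assumes "aw_star_subalgebra B"
  shows "x \<in> B \<Longrightarrow> y \<in> B \<Longrightarrow> x + y \<in> B" "x \<in> B \<Longrightarrow> y \<in> B \<Longrightarrow> x * y \<in> B"
    and "x \<in> B \<Longrightarrow> c *\<^sub>C x \<in> B" "x \<in> B \<Longrightarrow> r *\<^sub>R x \<in> B" "x \<in> B \<Longrightarrow> - x \<in> B"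
    and "x \<in> B \<Longrightarrow> y \<in> B \<Longrightarrow> x - y \<in> B" "0 \<in> B"
proof -
  have add: "x + y \<in> B" "x * y \<in> B" if "x \<in> B" "y \<in> B" for x y
    using assms that by (auto simp: aw_star_subalgebra_def)
  have scale: "c *\<^sub>C x \<in> B" if "x \<in> B" for c x
    using assms that by (auto simp: aw_star_subalgebra_def)
  have minus: "- x \<in> B" if "x \<in> B" for x
    using scale[OF that, of "-1"] by (simp add: scaleC_minus_left)
  \<comment> \<open>The annihilator of the empty set shows that \<open>B\<close> is not empty, which
    the other closure conditions alone would not give.\<close>
  have "\<exists>p. projection p \<and> right_annihilator ({} :: 'a set) = {p * x | x. True}"
    by (rule right_annihilator_eq)
  then obtain p where "p \<in> B" using assms unfolding aw_star_subalgebra_def by blast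
  from scale[OF this, of 0] show "0 \<in> B" by simp
  show "x \<in> B \<Longrightarrow> y \<in> B \<Longrightarrow> x + y \<in> B" "x \<in> B \<Longrightarrow> y \<in> B \<Longrightarrow> x * y \<in> B"
    "x \<in> B \<Longrightarrow> c *\<^sub>C x \<in> B" "x \<in> B \<Longrightarrow> - x \<in> B" by (auto intro: add scale minus)
  show "x \<in> B \<Longrightarrow> r *\<^sub>R x \<in> B" using scale[of x "of_real r"] by (simp add: scaleC_of_real)
  show "x \<in> B \<Longrightarrow> y \<in> B \<Longrightarrow> x - y \<in> B" using add(1)[of x "- y"] minus[of y] by simp
qed

lemma fcalc_mem:
  assumes B: "aw_star_subalgebra B" "a \<in> B" "1 \<in> B" and a: "fcalc_dom K a" "continuous_on UNIV f"
  shows "fcalc K a f \<in> B"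
proof -
  obtain P where lim: "(\<lambda>n. poly_eval a (P n)) \<longlonglongrightarrow> fcalc K a f"
    using fcalc_dom_limit[OF a] by (auto simp: fcalc_limit_def)
  have mem: "poly_eval a p \<in> B" for p
    using B by (induction p) (auto intro!: aw_star_subalgebra_mem)
  have "closed B" using B by (simp add: aw_star_subalgebra_def)
  then show ?thesis by (rule closed_sequentially[OF _ _ lim]) (rule mem)
qed

subsection \<open>Supports and spectral projections\<close>

text \<open>Taken from the annihilator axiom instead of minimality: the zero-product criterion and
  membership in AW*-subalgebras then follow directly.\<close>

definition right_support :: "'a::aw_star_algebra \<Rightarrow> 'a" where
  "right_support x = 1 - (SOME p. projection p \<and> right_annihilator {x} = {p * y | y. True})"

lemma right_support_ex:
  obtains p where "right_support x = 1 - p" "projection p" "right_annihilator {x} = {p * y | y. True}"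
  using someI_ex[OF right_annihilator_eq[of "{x}"]] unfolding right_support_def by blast

lemma projection_right_support: "projection (right_support x)"
proof (rule right_support_ex[of x])
  fix p assume "right_support x = 1 - p" "projection p"
  then show ?thesis by (simp add: projection_def adj_diff left_diff_distrib right_diff_distrib)
qed

lemma right_support_mult_eq_0_iff: "right_support x * y = 0 \<longleftrightarrow> x * y = 0"
proof (rule right_support_ex[of x])
  fix p assume p: "right_support x = 1 - p" "projection p"
    and ann: "right_annihilator {x} = {p * y | y. True}"
  have "x * y = 0 \<longleftrightarrow> y \<in> {p * z | z. True}"
    unfolding ann[symmetric] by (simp add: right_annihilator_def)
  also have "\<dots> \<longleftrightarrow> p * y = y"
    using p(2) by (auto simp: projection_def mult.assoc[symmetric]) metis
  finally show ?thesis by (auto simp: p(1) algebra_simps)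
qed

lemma right_support_mem:
  assumes B: "aw_star_subalgebra B" "x \<in> B" "1 \<in> B"
  shows "right_support x \<in> B"
proof (rule right_support_ex[of x])
  fix p assume p: "right_support x = 1 - p" "projection p"
    and ann: "right_annihilator {x} = {p * y | y. True}"
  have "p \<in> B" using B p(2) ann unfolding aw_star_subalgebra_def
    by (metis empty_subsetI insert_subset)
  then show ?thesis using B unfolding p(1) by (intro aw_star_subalgebra_mem)
qed

lemma mult_right_support: "x * right_support x = x"
proof -
  have "right_support x * (1 - right_support x) = 0"
    using projection_right_support[of x] by (simp add: projection_def algebra_simps)
  then have "x * (1 - right_support x) = 0" by (simp only: right_support_mult_eq_0_iff)
  then show ?thesis by (simp add: right_diff_distrib)
qed

lemma adj_right_support [simp]: "adj (right_support x) = right_support x"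
  using projection_right_support[of x] by (simp add: projection_def)

lemma right_support_idem [simp]: "right_support x * right_support x = right_support x"
  using projection_right_support[of x] by (simp add: projection_def)

lemma right_support_mult:
  assumes "adj x = x" shows "right_support x * x = x"
  using arg_cong[OF mult_right_support[of x], of adj] assms by (simp add: adj_mult)

lemma mult_right_support_eq_0:
  assumes "adj x = x" "adj y = y" "x * y = 0" shows "x * right_support y = 0"
proof -
  have "y * x = 0" using arg_cong[OF assms(3), of adj] assms(1,2) by (simp add: adj_mult)
  then have "right_support y * x = 0" by (simp add: right_support_mult_eq_0_iff)
  from arg_cong[OF this, of adj] show ?thesis using assms by (simp add: adj_mult)
qed

lemma right_support_intertwine:
  assumes x: "adj x = x" and y: "adj y = y" and xw: "x * w = w * y"
  shows "right_support x * w = w * right_support y"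
proof -
  \<comment> \<open>If \<open>x' w' = w' y'\<close>, then \<open>x'\<close> annihilates
    \<open>w' (1 - right_support y')\<close>, hence so does its support. This is half of the claim;
    the other half is the same fact for the adjoint relation
    \<open>y * adj w = adj w * x\<close>.\<close>
  have half: "right_support x' * w' = right_support x' * w' * right_support y'"
    if "x' * w' = w' * y'" for x' y' w' :: 'a
  proof -
    have "x' * (w' * (1 - right_support y')) = 0"
      using mult_right_support[of y'] that by (simp add: mult.assoc[symmetric])
        (simp add: algebra_simps)
    then have "right_support x' * (w' * (1 - right_support y')) = 0"
      by (simp add: right_support_mult_eq_0_iff)
    then show ?thesis by (simp add: algebra_simps)
  qed
  have "y * adj w = adj w * x" using arg_cong[OF xw, of adj] x y by (simp add: adj_mult)
  from half[OF this] have "adj (right_support y * adj w) = adj (right_support y * adj w * right_support x)"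
    by (rule arg_cong)
  then have "w * right_support y = right_support x * w * right_support y"
    by (simp add: adj_mult adj_adj mult.assoc)
  with half[OF xw] show ?thesis by simp
qed

lemma norm_projection_le:
  fixes p :: "'a::cstar_algebra"
  assumes "projection p" shows "norm p \<le> 1"
proof (cases "norm p = 0")
  case False
  have "(norm p)\<^sup>2 = norm p" using cstar_identity[of p] assms by (simp add: projection_def)
  with False show ?thesis by (simp add: power2_eq_square)
qed simp

text \<open>The spectral projection of \<open>a\<close> for the interval \<open>(t, \<infinity>)\<close>.\<close>

definition spec_above :: "real \<Rightarrow> 'a::aw_star_algebra \<Rightarrow> real \<Rightarrow> 'a" where
  "spec_above K a t = right_support (fcalc K a (\<lambda>x. max (x - t) 0))"

lemma continuous_ramp: "continuous_on UNIV (\<lambda>x::real. max (x - t) 0)"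
  by (intro continuous_intros)

text \<open>The positive part is cut into layers: \<open>u k\<close> is \<open>a - d k\<close>
  clamped to \<open>[0, d]\<close>. The error \<open>w k = d G k - u k\<close> of one layer lives
  where \<open>d k < a < d (k + 1)\<close>, so different errors are orthogonal and their sum is no
  larger than a single one.\<close>

lemma norm_positive_part_minus_step_le:
  fixes a :: "'a::aw_star_algebra"
  assumes a: "fcalc_dom K a" and d: "0 < d" and m: "K \<le> d * real m"
  shows "norm (fcalc K a (\<lambda>x. max x 0) - d *\<^sub>R (\<Sum>k<m. spec_above K a (d * real k))) \<le> d"
proof -
  define F where "F k x = max (x - d * real k) 0" for k and x :: real
  have F: "continuous_on UNIV (F k)" for k unfolding F_def by (rule continuous_ramp)
  define G where "G k = spec_above K a (d * real k)" for k
  have G: "G k = right_support (fcalc K a (F k))" for k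
    by (simp add: G_def spec_above_def F_def[abs_def])
  define u where "u k = fcalc K a (\<lambda>x. F k x - F (Suc k) x)" for k
  have uF: "continuous_on UNIV (\<lambda>x. F k x - F (Suc k) x)" for k by (intro continuous_intros F)
  have sa: "adj (fcalc K a (F k)) = fcalc K a (F k)" "adj (u k) = u k" for k
    unfolding u_def by (intro adj_fcalc a F uF)+
  have dF: "d * real (Suc k) = d * real k + d" for k by (simp add: algebra_simps)
  have uG: "u k * G k = u k" "G k * u k = u k" for k
  proof -
    \<comment> \<open>A continuous factor with \<open>\<kappa> * F k\<close> equal to the clamped
      layer; thus \<open>u k\<close> is a multiple of \<open>F k (a)\<close> and is absorbed by the
      support \<open>G k\<close>. The denominator is at least \<open>d\<close>.\<close>
    define \<kappa> where "\<kappa> x = d / max d (x - d * real k)" for x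
    have \<kappa>: "continuous_on UNIV \<kappa>" unfolding \<kappa>_def using d by (intro continuous_intros) auto
    have "\<kappa> x * F k x = F k x - F (Suc k) x" for x
      using d unfolding \<kappa>_def F_def dF by (auto simp: max_def field_simps)
    then have "u k = fcalc K a (\<lambda>x. \<kappa> x * F k x)" by (simp add: u_def)
    also have "\<dots> = fcalc K a \<kappa> * fcalc K a (F k)" by (intro fcalc_mult a \<kappa> F)
    finally show "u k * G k = u k" by (simp add: G mult.assoc mult_right_support)
    from arg_cong[OF this, of adj] show "G k * u k = u k" by (simp add: adj_mult sa(2)) (simp add: G)
  qed
  \<comment> \<open>Where \<open>F k\<close> is nonzero, every lower layer is already full, that is,
    equal to \<open>d\<close>.\<close>
  have next0: "(d *\<^sub>R 1 - u j) * G k = 0" if "j < k" for j k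
  proof -
    have "(d *\<^sub>R 1 - u j) * fcalc K a (F k) = fcalc K a (\<lambda>x. (d - (F j x - F (Suc j) x)) * F k x)"
      unfolding u_def fcalc_const[OF a, symmetric]
      by (subst fcalc_mult fcalc_diff; (intro a F continuous_intros)?)+ simp
    also have "\<dots> = fcalc K a (\<lambda>x. 0)"
    proof (rule fcalc_cong)
      fix t :: real
      have "d * real (Suc j) \<le> d * real k" using that d by (intro mult_left_mono) auto
      then show "(d - (F j t - F (Suc j) t)) * F k t = 0"
        using d unfolding F_def dF by (auto simp: max_def)
    qed
    also have "\<dots> = 0" by (simp add: fcalc_const[OF a])
    finally show ?thesis
      unfolding G by (rule mult_right_support_eq_0[rotated 2])
        (simp_all add: adj_diff adj_scaleR sa)
  qed
  define w where "w k = (d *\<^sub>R 1 - u k) * G k" for k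
  have w: "w k = d *\<^sub>R G k - u k" "w k = G k * (d *\<^sub>R 1 - u k)" for k
    by (simp_all add: w_def algebra_simps uG)
  have adjw: "adj (w k) = w k" for k
    unfolding w(1) by (simp add: adj_diff adj_scaleR sa) (simp add: G)
  have ww: "w j * w k = 0" if "j < k" for j k
  proof -
    have "w j * w k = G j * ((d *\<^sub>R 1 - u j) * G k) * (d *\<^sub>R 1 - u k)"
      unfolding w(2)[of j] w(2)[of k] by (simp only: mult.assoc)
    then show ?thesis by (simp add: next0[OF that])
  qed
  have ww': "w k * w j = 0" if "j < k" for j k
    using arg_cong[OF ww[OF that], of adj] by (simp add: adj_mult adjw)
  have "norm (\<Sum>k<m. w k) \<le> d"
  proof (rule norm_sum_orthogonal_le)
    fix k
    have "d *\<^sub>R 1 - u k = fcalc K a (\<lambda>x. d - (F k x - F (Suc k) x))"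
      unfolding u_def fcalc_const[OF a, symmetric]
      by (rule fcalc_diff[symmetric]) (intro a F continuous_intros)+
    also have "norm \<dots> \<le> d"
      using d unfolding F_def dF
      by (intro norm_fcalc_le a continuous_intros) (auto simp: max_def)
    finally have "norm (d *\<^sub>R 1 - u k) * norm (G k) \<le> d * 1"
      using d unfolding G by (intro mult_mono norm_projection_le projection_right_support) auto
    then show "norm (w k) \<le> d"
      unfolding w_def using norm_mult_ineq[of "d *\<^sub>R 1 - u k" "G k"] by simp
  next
    fix j k :: nat assume "j \<noteq> k"
    then show "w j * w k = 0" using ww[of j k] ww'[of k j] by (cases "j < k") auto
  qed (use d adjw in auto)
  moreover have "(\<Sum>k<m. u k) = fcalc K a (\<lambda>x. max x 0)"
  proof -
    have u: "u k = fcalc K a (F k) - fcalc K a (F (Suc k))" for k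
      unfolding u_def by (intro fcalc_diff a F)
    \<comment> \<open>The telescoping sum ends at \<open>F m\<close>, which vanishes on
      \<open>[-K, K]\<close> because the grid reaches \<open>d * m \<ge> K\<close>.\<close>
    have "fcalc K a (F m) = fcalc K a (\<lambda>x. 0)"
      using m by (intro fcalc_cong) (auto simp: F_def)
    then have "fcalc K a (F m) = 0" by (simp add: fcalc_const[OF a])
    moreover have "(\<Sum>k<m. u k) = fcalc K a (F 0) - fcalc K a (F m)"
      unfolding u by (rule sum_lessThan_telescope')
    ultimately show ?thesis by (simp add: F_def[abs_def])
  qed
  ultimately have "norm (d *\<^sub>R (\<Sum>k<m. G k) - fcalc K a (\<lambda>x. max x 0)) \<le> d"
    by (simp add: w(1) sum_subtractf scaleR_sum_right)
  then show ?thesis by (simp add: G_def norm_minus_commute)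
qed

lemma spec_above_intertwine:
  assumes a: "fcalc_dom K a" and b: "fcalc_dom K b" and w: "a * w = w * b"
  shows "spec_above K a t * w = w * spec_above K b t"
  unfolding spec_above_def
  by (intro right_support_intertwine adj_fcalc fcalc_intertwine a b w continuous_ramp)

lemma spec_above_commute:
  assumes a: "fcalc_dom K a" and b: "fcalc_dom K b" and ab: "a * b = b * a"
  shows "spec_above K a s * spec_above K b t = spec_above K b t * spec_above K a s"
  using spec_above_intertwine[OF b b, of "spec_above K a s" t]
    spec_above_intertwine[OF a a ab, of s] by metis

lemma spec_above_eigen:
  assumes a: "fcalc_dom K a" and w: "a * w = \<beta> *\<^sub>R w" and \<beta>: "\<bar>\<beta>\<bar> \<le> K"
  shows "spec_above K a t * w = of_bool (t < \<beta>) *\<^sub>R w"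
proof -
  define F where "F = fcalc K a (\<lambda>x. max (x - t) 0)"
  have G: "spec_above K a t = right_support F" by (simp add: spec_above_def F_def)
  have Fw: "F * w = max (\<beta> - t) 0 *\<^sub>R w"
    unfolding F_def by (rule fcalc_eigen[OF a continuous_ramp w \<beta>])
  show ?thesis
  proof (cases "t < \<beta>")
    case True
    then have w_eq: "w = (1 / (\<beta> - t)) *\<^sub>R (F * w)" by (simp add: Fw)
    have "right_support F * F = F"
      unfolding F_def by (intro right_support_mult adj_fcalc a continuous_ramp)
    then have "right_support F * (F * w) = F * w" by (simp add: mult.assoc[symmetric])
    then have "right_support F * ((1 / (\<beta> - t)) *\<^sub>R (F * w)) = (1 / (\<beta> - t)) *\<^sub>R (F * w)" by simp
    then show ?thesis using True unfolding w_eq[symmetric] G by simp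
  next
    case False
    then have "F * w = 0" by (simp add: Fw)
    then show ?thesis using False by (simp add: G right_support_mult_eq_0_iff)
  qed
qed

section \<open>Positive and negative parts, signs and reflections\<close>

lemma positive_negative_parts:
  assumes a: "fcalc_dom K a"
  shows "fcalc K a (\<lambda>x. max x 0) - fcalc K (- a) (\<lambda>x. max x 0) = a"
    and "fcalc K a (\<lambda>x. max x 0) * fcalc K (- a) (\<lambda>x. max x 0) = 0"
    and "fcalc K (- a) (\<lambda>x. max x 0) * fcalc K a (\<lambda>x. max x 0) = 0"
proof -
  have c: "continuous_on UNIV (\<lambda>x::real. max x 0)" "continuous_on UNIV (\<lambda>x::real. max (- x) 0)"
    by (intro continuous_intros)+
  have n: "fcalc K (- a) (\<lambda>x. max x 0) = fcalc K a (\<lambda>x. max (- x) 0)"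
    by (rule fcalc_uminus[OF a c(1)])
  have e: "(\<lambda>x::real. max x 0 - max (- x) 0) = (\<lambda>x. x)" "(\<lambda>x::real. max x 0 * max (- x) 0) = (\<lambda>x. 0)"
    "(\<lambda>x::real. max (- x) 0 * max x 0) = (\<lambda>x. 0)"
    by (auto simp: max_def fun_eq_iff)
  show "fcalc K a (\<lambda>x. max x 0) - fcalc K (- a) (\<lambda>x. max x 0) = a"
    unfolding n fcalc_diff[OF a c, symmetric] e by (rule fcalc_id[OF a])
  show "fcalc K a (\<lambda>x. max x 0) * fcalc K (- a) (\<lambda>x. max x 0) = 0"
    unfolding n fcalc_mult[OF a c, symmetric] e by (simp add: fcalc_const[OF a])
  show "fcalc K (- a) (\<lambda>x. max x 0) * fcalc K a (\<lambda>x. max x 0) = 0"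
    unfolding n fcalc_mult[OF a c(2,1), symmetric] e by (simp add: fcalc_const[OF a])
qed

text \<open>The sign is the difference of the spectral projections of \<open>h\<close> and
  \<open>- h\<close> for \<open>(0, \<infinity>)\<close>. Anticommutation reads
  \<open>h w = w (- h)\<close>, so the intertwining rule exchanges these two projections along
  \<open>w\<close>. The square of the sign is their sum, the support of \<open>h\<close>.\<close>

lemma sign_exists:
  fixes h :: "'a::aw_star_algebra"
  assumes h: "adj h = h"
  obtains S where "adj S = S" "projection (S * S)" "h * (S * S) = h"
    "\<And>w. h * w = - (w * h) \<Longrightarrow> S * w = - (w * S)"
proof -
  define K where "K = 2 * norm h + 1"
  have dom: "fcalc_dom K h" using h norm_ge_zero[of h] by (simp add: fcalc_dom_def K_def add_nonneg_pos)
  note dom' = fcalc_dom_uminus[OF dom]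
  define hp hn where "hp = fcalc K h (\<lambda>x. max x 0)" and "hn = fcalc K (- h) (\<lambda>x. max x 0)"
  define pos neg where "pos = spec_above K h 0" and "neg = spec_above K (- h) 0"
  have rs: "pos = right_support hp" "neg = right_support hn"
    by (simp_all add: pos_def neg_def spec_above_def hp_def hn_def)
  have parts: "hp - hn = h" "hp * hn = 0" "hn * hp = 0"
    unfolding hp_def hn_def by (rule positive_negative_parts[OF dom])+
  have sa: "adj hp = hp" "adj hn = hn"
    unfolding hp_def hn_def by (intro adj_fcalc dom dom' continuous_intros)+
  have cross: "hp * neg = 0" "hn * pos = 0"
    unfolding rs by (intro mult_right_support_eq_0 sa parts)+
  then have orth: "pos * neg = 0" "neg * pos = 0"
    unfolding rs by (simp_all add: right_support_mult_eq_0_iff)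
  have idem: "pos * pos = pos" "neg * neg = neg" "adj pos = pos" "adj neg = neg"
    by (simp_all add: rs)
  have SS: "(pos - neg) * (pos - neg) = pos + neg"
    by (simp add: algebra_simps idem orth)
  show thesis
  proof (rule that[of "pos - neg"])
    show "adj (pos - neg) = pos - neg" by (simp add: adj_diff idem)
    show "projection ((pos - neg) * (pos - neg))"
      unfolding SS projection_def by (simp add: adj_add idem orth algebra_simps)
    have "hp * pos = hp" "hn * neg = hn" by (simp_all add: rs mult_right_support)
    then have "(hp - hn) * (pos + neg) = hp - hn" by (simp add: algebra_simps cross)
    then show "h * ((pos - neg) * (pos - neg)) = h" unfolding SS parts .
    fix w assume w: "h * w = - (w * h)"
    have "pos * w = w * neg" "neg * w = w * pos"
      unfolding pos_def neg_def using w by (auto intro!: spec_above_intertwine dom dom')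
    then show "(pos - neg) * w = - (w * (pos - neg))" by (simp add: algebra_simps)
  qed
qed

text \<open>The element \<open>c = \<beta>(2p - 1) + j\<close> anticommutes with \<open>i j (2p - 1)\<close>.  Hence the sign of the latter
  implements a reflection of the spectrum of \<open>c\<close> on its support, off which \<open>j\<close> vanishes.\<close>

lemma reflection_exists:
  fixes p j :: "'a::aw_star_algebra"
  assumes p: "projection p" and j: "adj j = j" and pj: "p * j + j * p = j"
    and c: "c = \<beta> *\<^sub>R (2 *\<^sub>R p - 1) + j"
  obtains S where "adj S = S" "projection (S * S)" "S * c = - (c * S)" "S * p = (1 - p) * S"
    "c * (1 - S * S) = \<beta> *\<^sub>R ((2 *\<^sub>R p - 1) * (1 - S * S))"
proof -
  define s where "s = 2 *\<^sub>R p - 1"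
  have pp: "p * p = p" "adj p = p" using p by (auto simp: projection_def)
  have s: "adj s = s" "s * s = 1"
    by (simp_all add: s_def scaleR_2 adj_diff adj_add algebra_simps pp)
  have "2 *\<^sub>R (p * j) + 2 *\<^sub>R (j * p) = 2 *\<^sub>R j" using pj by (metis scaleR_add_right)
  then have sj: "s * j = - (j * s)"
    by (simp add: s_def algebra_simps scaleR_2 eq_neg_iff_add_eq_0)
  define h where "h = \<i> *\<^sub>C (j * s)"
  have h: "adj h = h"
    by (simp add: h_def adj_scaleC adj_mult j s sj scaleC_minus_left scaleC_minus_right)
  obtain S where S: "adj S = S" "projection (S * S)" "h * (S * S) = h"
    and anti: "\<And>w. h * w = - (w * h) \<Longrightarrow> S * w = - (w * S)"
    using sign_exists[OF h] by blast
  have hs: "h * s = - (s * h)"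
  proof -
    have "s * (j * s) = - (j * s * s)" using sj by (simp add: mult.assoc[symmetric])
    then show ?thesis
      by (simp add: h_def mult_scaleC_left mult_scaleC_right scaleC_minus_right)
  qed
  have hj: "h * j = - (j * h)"
    by (simp add: h_def mult_scaleC_left mult_scaleC_right scaleC_minus_right[symmetric] mult.assoc sj)
  have Sc: "S * c = - (c * S)"
    by (rule anti) (simp add: c s_def[symmetric] distrib_left distrib_right hs hj)
  have Ss: "S * s = - (s * S)" by (rule anti) (rule hs)
  have Sp: "S * p = (1 - p) * S"
  proof -
    have p_eq: "p = (1/2) *\<^sub>R (1 + s)" by (simp add: s_def)
    have q_eq: "1 - p = (1/2) *\<^sub>R (1 - s)"
      by (simp add: s_def scaleR_diff_right) (simp add: scaleR_2[symmetric] algebra_simps)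
    show ?thesis unfolding q_eq by (subst p_eq) (simp add: distrib_left left_diff_distrib Ss)
  qed
  \<comment> \<open>From \<open>h\<close> back to \<open>j\<close>: the factor \<open>\<i>\<close>
    is cancelled, \<open>s\<close> is moved past \<open>1 - S * S\<close> (it anticommutes with
    \<open>S\<close>, hence commutes with \<open>S * S\<close>), and \<open>s * s = 1\<close>
    removes it.\<close>
  have "h * (1 - S * S) = 0" using S by (simp add: right_diff_distrib)
  then have "(- \<i>) *\<^sub>C (h * (1 - S * S)) = 0" by simp
  then have "j * s * (1 - S * S) = 0" by (simp add: h_def mult_scaleC_left scaleC_scaleC)
  moreover have "S * S * s = s * (S * S)"
  proof -
    have "S * S * s = S * (S * s)" by (rule mult.assoc)
    also have "\<dots> = - (S * s * S)" by (subst Ss) (simp add: mult.assoc)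
    also have "\<dots> = s * S * S" unfolding Ss by simp
    also have "\<dots> = s * (S * S)" by (rule mult.assoc)
    finally show ?thesis .
  qed
  then have "s * (1 - S * S) = (1 - S * S) * s" by (simp add: algebra_simps)
  ultimately have "j * ((1 - S * S) * s) * s = 0" by (simp add: mult.assoc)
  then have "j * (1 - S * S) = 0" by (simp add: mult.assoc s)
  then have "c * (1 - S * S) = \<beta> *\<^sub>R ((2 *\<^sub>R p - 1) * (1 - S * S))"
    by (simp add: c distrib_right)
  then show thesis using that S Sc Sp by blast
qed

subsection \<open>Traces of elements with finite spectrum\<close>

lemma projection_mult:
  "projection (p :: 'a::cstar_algebra) \<Longrightarrow> projection q \<Longrightarrow> p * q = q * p \<Longrightarrow> projection (p * q)"
  unfolding projection_def by (metis adj_mult mult.assoc)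

lemma projection_one_minus: "projection (p :: 'a::cstar_algebra) \<Longrightarrow> projection (1 - p)"
  by (simp add: projection_def adj_diff algebra_simps)

text \<open>Unlike the representations inside \<open>simple_trace\<close>, these sum to 1, so that
  double sums over two of them can be collapsed from either side. Zero projections and repeated
  coefficients are allowed.\<close>

definition resolution :: "nat \<Rightarrow> (nat \<Rightarrow> 'a::cstar_algebra) \<Rightarrow> bool" where
  "resolution n p \<longleftrightarrow> (\<forall>k<n. projection (p k)) \<and>
     (\<forall>j<n. \<forall>k<n. j \<noteq> k \<longrightarrow> p j * p k = 0) \<and> (\<Sum>k<n. p k) = 1"

lemma resolution_mult:
  assumes "resolution n p"
  shows "(\<Sum>k<n. x k *\<^sub>C p k) * (\<Sum>k<n. y k *\<^sub>C p k) = (\<Sum>k<n. (x k * y k) *\<^sub>C p k)"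
  unfolding sum_product
proof (rule sum.cong[OF refl])
  fix i assume i: "i \<in> {..<n}"
  have "x i *\<^sub>C p i * y j *\<^sub>C p j = (if j = i then (x i * y i) *\<^sub>C p i else 0)" if "j \<in> {..<n}" for j
    using assms i that
    by (auto simp: resolution_def projection_def mult_scaleC_left mult_scaleC_right scaleC_scaleC mult.commute[of "x i"])
  then show "(\<Sum>j<n. x i *\<^sub>C p i * y j *\<^sub>C p j) = (x i * y i) *\<^sub>C p i"
    using i by simp
qed

lemma resolution_mult_left:
  assumes "resolution n p" "i < n"
  shows "p i * (\<Sum>k<n. \<alpha> k *\<^sub>R p k) = \<alpha> i *\<^sub>R p i" "(\<Sum>k<n. \<alpha> k *\<^sub>R p k) * p i = \<alpha> i *\<^sub>R p i"
proof -
  have "p i * (\<alpha> k *\<^sub>R p k) = (if k = i then \<alpha> i *\<^sub>R p i else 0)"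
    "\<alpha> k *\<^sub>R p k * p i = (if k = i then \<alpha> i *\<^sub>R p i else 0)" if "k \<in> {..<n}" for k
    using assms that by (auto simp: resolution_def projection_def)
  then show "p i * (\<Sum>k<n. \<alpha> k *\<^sub>R p k) = \<alpha> i *\<^sub>R p i" "(\<Sum>k<n. \<alpha> k *\<^sub>R p k) * p i = \<alpha> i *\<^sub>R p i"
    using assms(2) by (simp_all add: sum_distrib_left sum_distrib_right)
qed

lemma finite_spectrum_resolution:
  assumes p: "resolution n p"
  shows "finite (spectrum (\<Sum>k<n. \<alpha> k *\<^sub>R p k))"
proof (rule finite_subset)
  show "spectrum (\<Sum>k<n. \<alpha> k *\<^sub>R p k) \<subseteq> (\<lambda>k. complex_of_real (\<alpha> k)) ` {..<n}"
  proof
    fix c assume c: "c \<in> spectrum (\<Sum>k<n. \<alpha> k *\<^sub>R p k)"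
    show "c \<in> (\<lambda>k. complex_of_real (\<alpha> k)) ` {..<n}"
    proof (rule ccontr)
      assume "c \<notin> (\<lambda>k. complex_of_real (\<alpha> k)) ` {..<n}"
      then have nz: "complex_of_real (\<alpha> k) - c \<noteq> 0" if "k < n" for k using that by auto
      define y where "y = (\<Sum>k<n. (1 / (complex_of_real (\<alpha> k) - c)) *\<^sub>C p k)"
      have one: "(\<Sum>k<n. p k) = 1" using p by (simp add: resolution_def)
      have "(\<Sum>k<n. \<alpha> k *\<^sub>R p k) - c *\<^sub>C 1 = (\<Sum>k<n. (complex_of_real (\<alpha> k) - c) *\<^sub>C p k)"
        unfolding one[symmetric] linear_sum[OF bounded_linear.linear[OF bounded_linear_scaleC]]
        by (simp add: sum_subtractf scaleC_of_real scaleC_diff_left)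
      moreover have "(\<Sum>k<n. (1 / (complex_of_real (\<alpha> k) - c) * (complex_of_real (\<alpha> k) - c)) *\<^sub>C p k) = 1"
        "(\<Sum>k<n. ((complex_of_real (\<alpha> k) - c) * (1 / (complex_of_real (\<alpha> k) - c))) *\<^sub>C p k) = 1"
        unfolding one[symmetric] using nz by (auto intro!: sum.cong)
      ultimately have "y * ((\<Sum>k<n. \<alpha> k *\<^sub>R p k) - c *\<^sub>C 1) = 1 \<and> ((\<Sum>k<n. \<alpha> k *\<^sub>R p k) - c *\<^sub>C 1) * y = 1"
        unfolding y_def by (simp only: resolution_mult[OF p] simp_thms)
      with c show False by (auto simp: spectrum_def)
    qed
  qed
qed simp

lemma sum_lessThan_add: "(\<Sum>k<n + (m::nat). f k) = (\<Sum>k<n. f k) + (\<Sum>k<m. f (n + k))"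
  for f :: "nat \<Rightarrow> 'b::comm_monoid_add"
  by (induction m) (auto simp: add.assoc)

context
  fixes D :: "'a::aw_star_factor_II1 \<Rightarrow> real"
  assumes D: "dimension_function D"
begin

lemma D_add: "projection p \<Longrightarrow> projection q \<Longrightarrow> p * q = 0 \<Longrightarrow> D (p + q) = D p + D q"
  using D by (simp add: dimension_function_def)

lemma D_0: "D 0 = 0"
  using D_add[of 0 0] by (simp add: projection_def)

lemma D_1: "D 1 = 1"
  using D by (simp add: dimension_function_def)

lemma D_eq_adj_mult:
  "projection (adj x * x) \<Longrightarrow> projection (x * adj x) \<Longrightarrow> D (adj x * x) = D (x * adj x)"
  using D unfolding dimension_function_def mvn_equiv_def by blast

lemma D_split:
  assumes "projection p" "projection q" "p * q = q * p"
  shows "D p = D (p * q) + D (p * (1 - q))"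
proof -
  have "p * q * (p * (1 - q)) = p * p * (q * (1 - q))"
    using assms(3) by (simp add: mult.assoc) (simp add: mult.assoc[symmetric])
  then have "p * q * (p * (1 - q)) = 0" using assms by (simp add: projection_def algebra_simps)
  then have "D (p * q + p * (1 - q)) = D (p * q) + D (p * (1 - q))"
    using assms by (intro D_add projection_mult projection_one_minus) (auto simp: algebra_simps)
  then show ?thesis by (simp add: algebra_simps)
qed

lemma D_sum:
  assumes "finite I" "\<And>i. i \<in> I \<Longrightarrow> projection (p i)"
    and "\<And>i j. i \<in> I \<Longrightarrow> j \<in> I \<Longrightarrow> i \<noteq> j \<Longrightarrow> p i * p j = 0"
  shows "projection (\<Sum>i\<in>I. p i) \<and> D (\<Sum>i\<in>I. p i) = (\<Sum>i\<in>I. D (p i))"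
  using assms
proof (induction I rule: finite_induct)
  case empty
  then show ?case by (simp add: D_0) (simp add: projection_def)
next
  case (insert i I)
  have IH: "projection (sum p I)" "D (sum p I) = (\<Sum>i\<in>I. D (p i))"
    using insert.IH insert.prems by simp_all
  have pI: "p i * p j = 0" "p j * p i = 0" if "j \<in> I" for j
    using insert.prems(2)[of i j] insert.prems(2)[of j i] insert.hyps that by auto
  have 0: "p i * sum p I = 0" "sum p I * p i = 0"
    unfolding sum_distrib_left sum_distrib_right by (intro sum.neutral ballI pI; assumption)+
  have "projection (p i)" using insert.prems(1) by simp
  with 0 have "projection (p i + sum p I)"
    using IH(1) by (simp add: projection_def adj_add algebra_simps)
  moreover have "D (p i + sum p I) = D (p i) + D (sum p I)"
    using IH(1) 0 \<open>projection (p i)\<close> by (intro D_add)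
  ultimately show ?case using insert.hyps IH by simp
qed

text \<open>Projections from the two resolutions are orthogonal unless their coefficients agree. So
  for each value \<open>g\<close> the projections with coefficient \<open>g\<close> have the same
  sum on both sides, the spectral projection at \<open>g\<close>, and both traces can be regrouped
  by values.\<close>

lemma resolution_trace_unique:
  assumes p: "resolution n p" and q: "resolution m q"
    and eq: "(\<Sum>k<n. \<alpha> k *\<^sub>R p k) = (\<Sum>k<m. \<beta> k *\<^sub>R q k)"
  shows "(\<Sum>k<n. \<alpha> k * D (p k)) = (\<Sum>k<m. \<beta> k * D (q k))"
proof -
  have pq: "p i * q j = 0" if "i < n" "j < m" "\<alpha> i \<noteq> \<beta> j" for i j
  proof -
    \<comment> \<open>The common element is multiplied by \<open>p i\<close> on the left and by
      \<open>q j\<close> on the right.\<close>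
    have "\<alpha> i *\<^sub>R p i * q j = p i * (\<beta> j *\<^sub>R q j)"
      by (simp only: resolution_mult_left(1)[OF p that(1), of \<alpha>, symmetric]
          resolution_mult_left(2)[OF q that(2), of \<beta>, symmetric] eq mult.assoc)
    then show ?thesis using that(3) by simp
  qed
  have pq': "\<alpha> i = \<beta> j" if "p i * q j \<noteq> 0" "i < n" "j < m" for i j
    using pq that by blast
  define P where "P g = (\<Sum>i | i \<in> {..<n} \<and> \<alpha> i = g. p i)" for g
  define Q where "Q g = (\<Sum>i | i \<in> {..<m} \<and> \<beta> i = g. q i)" for g
  have PQ: "P g = Q g" for g
  proof -
    have "P g = P g * (\<Sum>j<m. q j)" using q by (simp add: resolution_def)
    also have "\<dots> = (\<Sum>i | i \<in> {..<n} \<and> \<alpha> i = g. \<Sum>j<m. p i * q j)"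
      by (simp add: P_def sum_product)
    also have "\<dots> = (\<Sum>i | i \<in> {..<n} \<and> \<alpha> i = g. \<Sum>j | j \<in> {..<m} \<and> \<beta> j = g. p i * q j)"
      by (intro sum.cong[OF refl] sum.mono_neutral_right) (auto dest!: pq'[symmetric])
    also have "\<dots> = (\<Sum>j | j \<in> {..<m} \<and> \<beta> j = g. \<Sum>i | i \<in> {..<n} \<and> \<alpha> i = g. p i * q j)"
      by (rule sum.swap)
    also have "\<dots> = (\<Sum>j | j \<in> {..<m} \<and> \<beta> j = g. \<Sum>i<n. p i * q j)"
      by (intro sum.cong[OF refl] sum.mono_neutral_left) (auto dest!: pq'[symmetric])
    also have "\<dots> = (\<Sum>i<n. p i) * Q g"
      by (simp add: Q_def sum_product sum.swap[of _ "{..<n}"])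
    also have "\<dots> = Q g" using p by (simp add: resolution_def)
    finally show ?thesis .
  qed
  \<comment> \<open>One index set for both sides; a value missing on one side contributes an empty
    sum there, of dimension 0.\<close>
  define V where "V = \<alpha> ` {..<n} \<union> \<beta> ` {..<m}"
  have grp: "(\<Sum>k<l. \<gamma> k * D (r k)) = (\<Sum>g\<in>V. g * D (\<Sum>i | i \<in> {..<l} \<and> \<gamma> i = g. r i))"
    if r: "resolution l r" and V: "\<gamma> ` {..<l} \<subseteq> V" for l \<gamma> r
  proof -
    have "(\<Sum>k<l. \<gamma> k * D (r k)) = (\<Sum>g\<in>V. \<Sum>i | i \<in> {..<l} \<and> \<gamma> i = g. \<gamma> i * D (r i))"
      by (rule sum.group[symmetric]) (auto simp: V_def V[unfolded V_def])
    also have "\<dots> = (\<Sum>g\<in>V. g * D (\<Sum>i | i \<in> {..<l} \<and> \<gamma> i = g. r i))"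
    proof (rule sum.cong[OF refl])
      fix g
      have "D (\<Sum>i | i \<in> {..<l} \<and> \<gamma> i = g. r i) = (\<Sum>i | i \<in> {..<l} \<and> \<gamma> i = g. D (r i))"
        using r by (intro D_sum[THEN conjunct2]) (auto simp: resolution_def)
      then show "(\<Sum>i | i \<in> {..<l} \<and> \<gamma> i = g. \<gamma> i * D (r i)) = g * D (\<Sum>i | i \<in> {..<l} \<and> \<gamma> i = g. r i)"
        by (simp add: sum_distrib_left)
    qed
    finally show ?thesis .
  qed
  have "(\<Sum>k<n. \<alpha> k * D (p k)) = (\<Sum>g\<in>V. g * D (P g))"
    unfolding P_def by (rule grp[OF p]) (simp add: V_def)
  also have "\<dots> = (\<Sum>g\<in>V. g * D (Q g))" by (simp add: PQ)
  also have "\<dots> = (\<Sum>k<m. \<beta> k * D (q k))"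
    unfolding Q_def by (rule grp[OF q, symmetric]) (simp add: V_def)
  finally show ?thesis .
qed

lemma simple_trace_resolution:
  assumes p: "resolution n p"
  shows "simple_trace D (\<Sum>k<n. \<alpha> k *\<^sub>R p k) = (\<Sum>k<n. \<alpha> k * D (p k))"
  unfolding simple_trace_def
proof (rule the_equality)
  show "\<exists>(m::nat) \<beta> q. (\<forall>k<m. projection (q k)) \<and> (\<forall>j<m. \<forall>k<m. j \<noteq> k \<longrightarrow> q j * q k = 0) \<and>
      (\<Sum>k<n. \<alpha> k *\<^sub>R p k) = (\<Sum>k<m. \<beta> k *\<^sub>R q k) \<and>
      (\<Sum>k<n. \<alpha> k * D (p k)) = (\<Sum>k<m. \<beta> k * D (q k))"
    by (intro exI[of _ n] exI[of _ \<alpha>] exI[of _ p]) (use p in \<open>simp add: resolution_def\<close>)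
next
  fix r
  assume "\<exists>(m::nat) \<beta> q. (\<forall>k<m. projection (q k)) \<and> (\<forall>j<m. \<forall>k<m. j \<noteq> k \<longrightarrow> q j * q k = 0) \<and>
      (\<Sum>k<n. \<alpha> k *\<^sub>R p k) = (\<Sum>k<m. \<beta> k *\<^sub>R q k) \<and> r = (\<Sum>k<m. \<beta> k * D (q k))"
  then obtain m :: nat and \<beta> q where q: "\<And>k. k < m \<Longrightarrow> projection (q k)"
    "\<And>j k. j < m \<Longrightarrow> k < m \<Longrightarrow> j \<noteq> k \<Longrightarrow> q j * q k = 0"
    and eq: "(\<Sum>k<n. \<alpha> k *\<^sub>R p k) = (\<Sum>k<m. \<beta> k *\<^sub>R q k)" and r: "r = (\<Sum>k<m. \<beta> k * D (q k))"
    by blast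
  \<comment> \<open>An arbitrary representation is completed to a resolution by the complementary
    projection with coefficient 0, which changes neither the element nor the trace.\<close>
  define q' where "q' = q(m := 1 - (\<Sum>k<m. q k))"
  define \<beta>' where "\<beta>' = \<beta>(m := 0)"
  have less: "(\<Sum>k<m. f (q' k) (\<beta>' k)) = (\<Sum>k<m. f (q k) (\<beta> k))" for f :: "'a \<Rightarrow> real \<Rightarrow> 'b::comm_monoid_add"
    by (intro sum.cong) (auto simp: q'_def \<beta>'_def)
  have "projection (\<Sum>k<m. q k)" using q by (intro D_sum[THEN conjunct1]) auto
  then have pm: "projection (q' m)" by (simp add: q'_def projection_one_minus)
  have orth: "q k * q' m = 0" "q' m * q k = 0" if k: "k < m" for k
  proof -
    have "q k * q j = (if j = k then q k else 0)" "q j * q k = (if j = k then q k else 0)"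
      if "j \<in> {..<m}" for j
      using q k that by (auto simp: projection_def)
    then have "q k * (\<Sum>j<m. q j) = q k" "(\<Sum>j<m. q j) * q k = q k"
      using k by (simp_all add: sum_distrib_left sum_distrib_right)
    then show "q k * q' m = 0" "q' m * q k = 0" by (simp_all add: q'_def algebra_simps)
  qed
  have "resolution (Suc m) q'"
    unfolding resolution_def
  proof (intro conjI allI impI)
    fix k assume "k < Suc m"
    then show "projection (q' k)" using q pm by (cases "k = m") (auto simp: q'_def)
  next
    fix i k assume "i < Suc m" "k < Suc m" "i \<noteq> k"
    then show "q' i * q' k = 0"
      using q(2)[of i k] orth[of i] orth[of k] by (cases "i = m"; cases "k = m") (auto simp: q'_def)
  next
    show "(\<Sum>k<Suc m. q' k) = 1" using less[of "\<lambda>q b. q"] by (simp add: q'_def)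
  qed
  moreover have "(\<Sum>k<n. \<alpha> k *\<^sub>R p k) = (\<Sum>k<Suc m. \<beta>' k *\<^sub>R q' k)"
    using less[of "\<lambda>q b. b *\<^sub>R q"] by (simp add: eq) (simp add: \<beta>'_def)
  ultimately have "(\<Sum>k<n. \<alpha> k * D (p k)) = (\<Sum>k<Suc m. \<beta>' k * D (q' k))"
    by (rule resolution_trace_unique[OF p])
  then show "r = (\<Sum>k<n. \<alpha> k * D (p k))"
    using less[of "\<lambda>q b. b * D q"] by (simp add: r) (simp add: \<beta>'_def)
qed

text \<open>Each new projection splits every member of the resolution in two. The last clause of the
  statement is the induction invariant: it makes the next \<open>R i\<close> commute with all the
  members built so far. In this way nested projections can be traced although
  \<open>simple_trace\<close> asks for orthogonal ones.\<close>

lemma commuting_resolution: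
  assumes "finite I" "\<forall>i\<in>I. projection (R i)" "\<forall>i\<in>I. \<forall>j\<in>I. R i * R j = R j * R i"
  shows "\<exists>n \<alpha> p. resolution n p \<and>
    \<beta> *\<^sub>R 1 + (\<Sum>i\<in>I. r i *\<^sub>R R i) = (\<Sum>k<n. \<alpha> k *\<^sub>R p k) \<and>
    (\<Sum>k<n. \<alpha> k * D (p k)) = \<beta> + (\<Sum>i\<in>I. r i * D (R i)) \<and>
    (\<forall>w. (\<forall>i\<in>I. w * R i = R i * w) \<longrightarrow> (\<forall>k<n. w * p k = p k * w))"
  using assms
proof (induction I rule: finite_induct)
  case empty
  show ?case
    by (intro exI[of _ "1::nat"] exI[of _ "\<lambda>_. \<beta>"] exI[of _ "\<lambda>_. 1"])
       (simp add: resolution_def projection_def D_1)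
next
  case (insert i I)
  have "\<forall>i\<in>I. projection (R i)" "\<forall>i\<in>I. \<forall>j\<in>I. R i * R j = R j * R i"
    using insert.prems by simp_all
  from insert.IH[OF this] obtain n \<alpha> p where p: "resolution n p"
    and sum: "\<beta> *\<^sub>R 1 + (\<Sum>i\<in>I. r i *\<^sub>R R i) = (\<Sum>k<n. \<alpha> k *\<^sub>R p k)"
    and tr: "(\<Sum>k<n. \<alpha> k * D (p k)) = \<beta> + (\<Sum>i\<in>I. r i * D (R i))"
    and comm: "\<forall>w. (\<forall>i\<in>I. w * R i = R i * w) \<longrightarrow> (\<forall>k<n. w * p k = p k * w)"
    by (elim exE conjE)
  define T where "T = R i"
  have T: "projection T" "T * T = T" "projection (1 - T)" "(1 - T) * (1 - T) = 1 - T" "T * (1 - T) = 0" "(1 - T) * T = 0"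
    using insert.prems(1) projection_one_minus[of T] by (auto simp: T_def projection_def algebra_simps)
  have Tp: "T * p k = p k * T" "(1 - T) * p k = p k * (1 - T)" if "k < n" for k
    using comm[rule_format, of T k] insert.prems(2) that by (auto simp: T_def algebra_simps)
  \<comment> \<open>Indices below \<open>n\<close> hold the parts under \<open>T\<close>, whose
    coefficient grows by \<open>r i\<close>; indices from \<open>n\<close> on hold the parts under
    \<open>1 - T\<close>, with the coefficient unchanged.\<close>
  define p' where "p' k = (if k < n then p k * T else p (k - n) * (1 - T))" for k
  define \<alpha>' where "\<alpha>' k = (if k < n then \<alpha> k + r i else \<alpha> (k - n))" for k
  have split: "(\<Sum>k<n + n. f (\<alpha>' k) (p' k)) = (\<Sum>k<n. f (\<alpha> k + r i) (p k * T)) + (\<Sum>k<n. f (\<alpha> k) (p k * (1 - T)))"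
    for f :: "real \<Rightarrow> 'a \<Rightarrow> 'c::comm_monoid_add"
    by (simp add: sum_lessThan_add p'_def \<alpha>'_def)
  have one: "(\<Sum>k<n. p k) = 1" using p by (simp add: resolution_def)
  have pk: "projection (p k)" if "k < n" for k using p that by (simp add: resolution_def)
  have pT: "projection (p k * T)" "projection (p k * (1 - T))" if "k < n" for k
    using Tp[OF that] by (intro projection_mult pk that T; simp)+
  have prod: "p j * X * (p k * Y) = p j * p k * (X * Y)"
    if "X * p k = p k * X" for j k X Y
    by (metis that mult.assoc)
  have orth: "p j * p k = 0" if "j < n" "k < n" "j \<noteq> k" for j k
    using p that by (simp add: resolution_def)
  have res: "resolution (n + n) p'"
    unfolding resolution_def
  proof (intro conjI allI impI)
    fix k assume "k < n + n"
    then show "projection (p' k)" using pT[of k] pT[of "k - n"] by (auto simp: p'_def)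
  next
    fix j k assume jk: "j < n + n" "k < n + n" "j \<noteq> k"
    define j' k' where "j' = (if j < n then j else j - n)" and "k' = (if k < n then k else k - n)"
    have *: "j' < n" "k' < n" "j' = k' \<Longrightarrow> (j < n) \<noteq> (k < n)"
      using jk by (auto simp: j'_def k'_def split: if_splits)
    have "p' j * p' k = p j' * p k' * ((if j < n then T else 1 - T) * (if k < n then T else 1 - T))"
      using prod[of T k' j'] prod[of "1 - T" k' j'] Tp[OF *(2)] by (auto simp: p'_def j'_def k'_def)
    then show "p' j * p' k = 0"
      using orth[OF *(1,2)] *(3) T by (cases "j' = k'") (auto split: if_splits)
  next
    have "(\<Sum>k<n + n. p' k) = (\<Sum>k<n. p k) * T + (\<Sum>k<n. p k) * (1 - T)"
      using split[of "\<lambda>a p. p"] by (simp add: sum_distrib_right)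
    then show "(\<Sum>k<n + n. p' k) = 1" by (simp add: one)
  qed
  have "(\<Sum>k<n + n. \<alpha>' k *\<^sub>R p' k) = (\<Sum>k<n. (\<alpha> k + r i) *\<^sub>R (p k * T) + \<alpha> k *\<^sub>R (p k * (1 - T)))"
    using split[of scaleR] by (simp add: sum.distrib)
  also have "\<dots> = (\<Sum>k<n. \<alpha> k *\<^sub>R p k) + r i *\<^sub>R ((\<Sum>k<n. p k) * T)"
    unfolding sum_distrib_right scaleR_sum_right sum.distrib[symmetric]
    by (intro sum.cong) (auto simp: algebra_simps)
  also have "\<dots> = \<beta> *\<^sub>R 1 + (\<Sum>i\<in>insert i I. r i *\<^sub>R R i)"
    using insert.hyps sum by (simp add: one T_def algebra_simps)
  finally have sum': "\<beta> *\<^sub>R 1 + (\<Sum>i\<in>insert i I. r i *\<^sub>R R i) = (\<Sum>k<n + n. \<alpha>' k *\<^sub>R p' k)" ..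
  have DT: "D T = (\<Sum>k<n. D (p k * T))"
  proof -
    have "D (\<Sum>k<n. p k * T) = (\<Sum>k<n. D (p k * T))"
      using prod Tp orth pT by (intro D_sum[THEN conjunct2]) auto
    then show ?thesis by (simp add: sum_distrib_right[symmetric] one)
  qed
  have "(\<Sum>k<n + n. \<alpha>' k * D (p' k)) = (\<Sum>k<n. (\<alpha> k + r i) * D (p k * T) + \<alpha> k * D (p k * (1 - T)))"
    using split[of "\<lambda>a p. a * D p"] by (simp add: sum.distrib)
  also have "\<dots> = (\<Sum>k<n. \<alpha> k * D (p k) + r i * D (p k * T))"
  proof (intro sum.cong[OF refl])
    fix k assume "k \<in> {..<n}"
    then have "D (p k) = D (p k * T) + D (p k * (1 - T))" using Tp pk T by (intro D_split) auto
    then show "(\<alpha> k + r i) * D (p k * T) + \<alpha> k * D (p k * (1 - T)) = \<alpha> k * D (p k) + r i * D (p k * T)"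
      by (simp add: algebra_simps)
  qed
  also have "\<dots> = \<beta> + (\<Sum>i\<in>insert i I. r i * D (R i))"
    using insert.hyps tr DT by (simp add: sum.distrib sum_distrib_left[symmetric] T_def)
  finally have tr': "(\<Sum>k<n + n. \<alpha>' k * D (p' k)) = \<beta> + (\<Sum>i\<in>insert i I. r i * D (R i))" .
  have comm': "w * p' k = p' k * w" if w: "\<forall>i\<in>insert i I. w * R i = R i * w" and k: "k < n + n" for w k
  proof -
    have wT: "w * T = T * w" "w * (1 - T) = (1 - T) * w"
      using w by (auto simp: T_def algebra_simps)
    have wp: "w * p l = p l * w" if "l < n" for l using comm w that by blast
    show ?thesis
    proof (cases "k < n")
      case True
      then show ?thesis unfolding p'_def using wp[OF True] wT by simp (metis mult.assoc)
    next
      case False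
      then have "k - n < n" using k by simp
      with False show ?thesis unfolding p'_def using wp[of "k - n"] wT by simp (metis mult.assoc)
    qed
  qed
  show ?case
    by (intro exI[of _ "n + n"] exI[of _ \<alpha>'] exI[of _ p'] conjI allI impI res sum' tr' comm')
qed

lemma simple_trace_commuting:
  assumes "finite I" "\<forall>i\<in>I. projection (R i)" "\<forall>i\<in>I. \<forall>j\<in>I. R i * R j = R j * R i"
  shows "simple_trace D (\<beta> *\<^sub>R 1 + (\<Sum>i\<in>I. r i *\<^sub>R R i)) = \<beta> + (\<Sum>i\<in>I. r i * D (R i))"
    and "finite (spectrum (\<beta> *\<^sub>R 1 + (\<Sum>i\<in>I. r i *\<^sub>R R i)))"
proof -
  obtain n \<alpha> p where "resolution n p"
    "\<beta> *\<^sub>R 1 + (\<Sum>i\<in>I. r i *\<^sub>R R i) = (\<Sum>k<n. \<alpha> k *\<^sub>R p k)"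
    "(\<Sum>k<n. \<alpha> k * D (p k)) = \<beta> + (\<Sum>i\<in>I. r i * D (R i))"
    using commuting_resolution[OF assms, where \<beta> = \<beta> and r = r] by blast
  then show "simple_trace D (\<beta> *\<^sub>R 1 + (\<Sum>i\<in>I. r i *\<^sub>R R i)) = \<beta> + (\<Sum>i\<in>I. r i * D (R i))"
    and "finite (spectrum (\<beta> *\<^sub>R 1 + (\<Sum>i\<in>I. r i *\<^sub>R R i)))"
    by (simp_all add: simple_trace_resolution finite_spectrum_resolution)
qed

end

subsection \<open>The quasi-trace of off-diagonal perturbations\<close>

lemma positive_part_minus_step_le:
  fixes b d :: real
  assumes d: "0 < d" and m: "b \<le> d * real m"
  shows "\<bar>d * (\<Sum>k<m. of_bool (d * real k < b)) - max b 0\<bar> \<le> d"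
proof -
  define T where "T n = d * (\<Sum>k<n. of_bool (d * real k < b))" for n
  \<comment> \<open>The last conjunct strengthens the induction: while the grid is below
    \<open>b\<close>, the sum is exactly \<open>d * n\<close>, and this bounds the overshoot at the
    final step by \<open>d\<close>.\<close>
  have "T n \<le> max b 0 + d \<and> min (max b 0) (d * real n) \<le> T n \<and> (d * real n < b \<longrightarrow> T n = d * real n)" for n
  proof (induction n)
    case 0
    then show ?case using d by (simp add: T_def)
  next
    case (Suc n)
    have T: "T (Suc n) = T n + d * of_bool (d * real n < b)" by (simp add: T_def distrib_left)
    have dn: "d * real (Suc n) = d * real n + d" "0 \<le> d * real n" using d by (auto simp: algebra_simps)
    show ?case
      using Suc d dn(2) unfolding T dn(1) by (cases "d * real n < b") auto
  qed
  from this[of m] have "T m \<le> max b 0 + d" "min (max b 0) (d * real m) \<le> T m" by blast+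
  moreover have "0 \<le> d * real m" using d by simp
  ultimately show ?thesis using m d unfolding T_def by linarith
qed

lemma odd_step_function_approx:
  fixes \<beta> d :: real
  assumes d: "0 < d" and m: "\<bar>\<beta>\<bar> \<le> d * real m"
  shows "\<bar>d * (\<Sum>k<m. of_bool (d * real k < \<beta>) - of_bool (d * real k < - \<beta>)) - \<beta>\<bar> \<le> 2 * d"
proof -
  have "max \<beta> 0 - max (- \<beta>) 0 = \<beta>" by (simp add: max_def)
  then show ?thesis
    using positive_part_minus_step_le[OF d, of \<beta> m] positive_part_minus_step_le[OF d, of "- \<beta>" m] m
    unfolding sum_subtractf right_diff_distrib by linarith
qed

text \<open>The two projections are cut by \<open>P = S * S\<close>. Under \<open>P\<close> they are
  equivalent through \<open>S\<close>. On the complement, \<open>c\<close> acts as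
  \<open>\<beta>\<close> on \<open>w\<close> and as \<open>- \<beta>\<close> on \<open>w'\<close>,
  so each of them restricts to a sum of some of \<open>w\<close> and \<open>w'\<close>; only
  \<open>D w - D w'\<close> survives, and it equals \<open>D p - D (1 - p)\<close> because
  \<open>S * p\<close> makes \<open>p * P\<close> and \<open>(1 - p) * P\<close> equivalent.\<close>

lemma dimension_spec_above_diff:
  fixes D :: "'a::aw_star_factor_II1 \<Rightarrow> real"
  assumes D: "dimension_function D" and p: "projection p"
    and S: "adj S = S" "projection (S * S)" "S * c = - (c * S)" "S * p = (1 - p) * S"
    and cS: "c * (1 - S * S) = \<beta> *\<^sub>R ((2 *\<^sub>R p - 1) * (1 - S * S))"
    and c: "fcalc_dom K c" and \<beta>: "\<bar>\<beta>\<bar> \<le> K"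
  shows "D (spec_above K c t) - D (spec_above K (- c) t)
    = (of_bool (t < \<beta>) - of_bool (t < - \<beta>)) * (2 * D p - 1)"
proof -
  note D_rules = D_add[OF D] D_0[OF D] D_1[OF D] D_split[OF D]
  note c' = fcalc_dom_uminus[OF c]
  define P where "P = S * S"
  define R where "R = 1 - P"
  have P: "projection P" using S(2) by (simp add: P_def)
  have R: "projection R" unfolding R_def by (rule projection_one_minus[OF P])
  have pp: "p * p = p" using p by (simp add: projection_def)
  have RR: "R * R = R" using R by (simp add: projection_def)
  have Sp': "S * (1 - p) = p * S" using S(4) by (simp add: algebra_simps)
  have Pp: "P * p = p * P"
  proof -
    have "P * p = S * (S * p)" by (simp add: P_def mult.assoc)
    also have "\<dots> = S * (1 - p) * S" by (simp only: S(4) mult.assoc)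
    also have "\<dots> = p * P" by (simp only: Sp' P_def mult.assoc)
    finally show ?thesis .
  qed
  have Pq: "P * (1 - p) = (1 - p) * P" using Pp by (simp add: algebra_simps)
  have Rp: "R * p = p * R" "R * (1 - p) = (1 - p) * R"
    using Pp by (simp_all add: R_def algebra_simps)
  note q = projection_one_minus[OF p]
  define w w' where "w = p * R" and "w' = (1 - p) * R"
  have w: "projection w" "projection w'"
    unfolding w_def w'_def using Rp by (intro projection_mult p q R; simp)+
  have ww': "w * w' = 0"
  proof -
    have "w * w' = p * (R * (1 - p)) * R" by (simp add: w_def w'_def mult.assoc)
    also have "\<dots> = p * (1 - p) * (R * R)" by (simp only: Rp mult.assoc)
    finally show ?thesis by (simp add: right_diff_distrib pp)
  qed
  have Dw: "D w - D w' = 2 * D p - 1"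
  proof -
    have "adj (S * p) * (S * p) = p * P"
    proof -
      have "adj (S * p) * (S * p) = p * (P * p)"
        using p S(1) by (simp add: adj_mult P_def mult.assoc projection_def)
      also have "\<dots> = p * p * P" by (simp only: Pp mult.assoc)
      finally show ?thesis by (simp only: pp)
    qed
    moreover have "S * p * adj (S * p) = (1 - p) * P"
    proof -
      have "S * p * adj (S * p) = S * p * (p * S)"
        using p S(1) by (simp add: adj_mult projection_def)
      also have "\<dots> = S * p * S" by (simp add: mult.assoc[symmetric]) (simp add: mult.assoc pp)
      also have "\<dots> = (1 - p) * P" by (simp only: S(4) P_def mult.assoc)
      finally show ?thesis .
    qed
    ultimately have "D (p * P) = D ((1 - p) * P)"
      using D_eq_adj_mult[OF D, of "S * p"] projection_mult[OF p P Pp[symmetric]]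
        projection_mult[OF q P Pq[symmetric]] by simp
    moreover have "D p = D (p * P) + D w" "D (1 - p) = D ((1 - p) * P) + D w'"
      unfolding w_def w'_def R_def using Pp Pq by (intro D_rules p q P; simp)+
    moreover have "D p + D (1 - p) = 1"
      using D_rules(1)[OF p q] D_rules(3) by (simp add: right_diff_distrib pp)
    ultimately show ?thesis by linarith
  qed
  have cw: "c * w = \<beta> *\<^sub>R w" "c * w' = (- \<beta>) *\<^sub>R w'"
  proof -
    have cR: "c * R = \<beta> *\<^sub>R ((2 *\<^sub>R p - 1) * R)" using cS by (simp add: R_def P_def)
    have "c * w = c * R * p" by (simp add: w_def mult.assoc Rp)
    also have "\<dots> = \<beta> *\<^sub>R ((2 *\<^sub>R p - 1) * p * R)" unfolding cR by (simp add: mult.assoc Rp)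
    also have "(2 *\<^sub>R p - 1) * p = p" by (simp add: algebra_simps pp scaleR_2)
    finally show "c * w = \<beta> *\<^sub>R w" by (simp add: w_def)
    have "c * w' = c * R * (1 - p)" by (simp add: w'_def mult.assoc Rp)
    also have "\<dots> = \<beta> *\<^sub>R ((2 *\<^sub>R p - 1) * (1 - p) * R)"
      unfolding cR by (simp add: mult.assoc Rp(2))
    also have "(2 *\<^sub>R p - 1) * (1 - p) = - (1 - p)"
      by (simp add: algebra_simps pp scaleR_2)
    finally show "c * w' = (- \<beta>) *\<^sub>R w'" by (simp only: w'_def mult_minus_left scaleR_minus_left scaleR_minus_right)
  qed
  have part: "D X = D (X * P) + of_bool (t < b) * D w + of_bool (t < - b) * D w'"
    if X: "projection X" "X * P = P * X" and Xw: "X * w = of_bool (t < b) *\<^sub>R w"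
      "X * w' = of_bool (t < - b) *\<^sub>R w'" for X b
  proof -
    have "D X = D (X * P) + D (X * R)"
      unfolding R_def by (rule D_rules(4)[OF X(1) P X(2)])
    moreover have "R = w + w'" by (simp add: w_def w'_def algebra_simps)
    then have "X * R = of_bool (t < b) *\<^sub>R w + of_bool (t < - b) *\<^sub>R w'"
      by (simp only: distrib_left Xw)
    moreover have "D (of_bool (t < b) *\<^sub>R w + of_bool (t < - b) *\<^sub>R w')
        = of_bool (t < b) * D w + of_bool (t < - b) * D w'"
      using D_rules(1)[OF w ww'] D_rules(2) by (simp add: of_bool_def)
    ultimately show ?thesis by simp
  qed
  define G H where "G = spec_above K c t" and "H = spec_above K (- c) t"
  have GH: "projection G" "projection H"
    by (simp_all add: G_def H_def spec_above_def projection_right_support)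
  have "c * S = S * (- c)" using S(3) by simp
  then have GS: "G * S = S * H"
    unfolding G_def H_def by (intro spec_above_intertwine c c')
  have HS: "H * S = S * G"
    unfolding G_def H_def using S(3) by (intro spec_above_intertwine c c') simp
  have comm: "G * P = P * G" "H * P = P * H"
    unfolding P_def by (simp_all add: mult.assoc[symmetric] GS HS) (simp_all add: mult.assoc GS HS)
  have "D (G * P) = D (H * P)"
  proof -
    have GG: "G * G = G" "adj G = G" using GH by (simp_all add: projection_def)
    have "adj (S * G) * (S * G) = G * (P * G)"
      by (simp add: adj_mult S(1) GG P_def mult.assoc)
    also have "\<dots> = G * P" by (simp only: comm(1)[symmetric]) (simp add: mult.assoc[symmetric] GG)
    finally have 1: "adj (S * G) * (S * G) = G * P" .
    have "S * G * adj (S * G) = H * S * (G * S)"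
      by (simp add: adj_mult S(1) GG HS)
    also have "\<dots> = H * (S * S) * H" by (simp only: GS mult.assoc)
    also have "\<dots> = H * H * P" by (simp only: P_def[symmetric] comm(2)[symmetric] mult.assoc)
    finally have 2: "S * G * adj (S * G) = H * P" using GH(2) by (simp add: projection_def)
    show ?thesis
      using D_eq_adj_mult[OF D, of "S * G"] projection_mult[OF GH(1) P comm(1)]
        projection_mult[OF GH(2) P comm(2)] by (simp add: 1 2)
  qed
  moreover have "D G = D (G * P) + of_bool (t < \<beta>) * D w + of_bool (t < - \<beta>) * D w'"
    unfolding G_def using cw \<beta> GH comm
    by (intro part spec_above_eigen c) (auto simp: G_def)
  \<comment> \<open>Here \<open>part\<close> is used with \<open>b = - \<beta>\<close>, since
    \<open>- c\<close> has eigenvalue \<open>- \<beta>\<close> on \<open>w\<close> and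
    \<open>\<beta>\<close> on \<open>w'\<close>; the double negation keeps its shape.\<close>
  moreover have "D H = D (H * P) + of_bool (t < - \<beta>) * D w + of_bool (t < - (- \<beta>)) * D w'"
    unfolding H_def using cw \<beta> GH comm
    by (intro part spec_above_eigen c') (auto simp: H_def)
  ultimately have "D G - D H = (of_bool (t < \<beta>) - of_bool (t < - \<beta>)) * (D w - D w')"
    by (simp add: algebra_simps)
  then show ?thesis by (simp only: Dw G_def H_def)
qed

text \<open>Over the symmetric part of the spectrum of \<open>c = a - \<alpha>/2\<close> the contributions cancel.  The rest of
  \<open>c\<close> is a restriction of \<open>\<alpha>/2 (2p - 1)\<close>.\<close>

lemma quasi_trace_sa_offdiagonal:
  fixes D :: "'a::aw_star_factor_II1 \<Rightarrow> real"
  assumes D: "dimension_function D" and q: "quasi_trace_sa D q"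
    and p: "projection p" and j: "adj j = j" and pj: "p * j + j * p = j"
  shows "q (\<alpha> *\<^sub>R p + j) = \<alpha> * D p"
proof -
  define a where "a = \<alpha> *\<^sub>R p + j"
  define \<beta> where "\<beta> = \<alpha> / 2"
  define c where "c = \<beta> *\<^sub>R (2 *\<^sub>R p - 1) + j"
  have ac: "a = \<beta> *\<^sub>R 1 + c" by (simp add: a_def c_def \<beta>_def scaleR_diff_right)
  have adjp: "adj p = p" using p by (simp add: projection_def)
  have adjc: "adj c = c" by (simp add: c_def adj_add adj_diff adj_scaleR adjp j)
  have adja: "adj a = a" by (simp add: a_def adj_add adj_scaleR adjp j)
  obtain S where S: "adj S = S" "projection (S * S)" "S * c = - (c * S)" "S * p = (1 - p) * S"
    "c * (1 - S * S) = \<beta> *\<^sub>R ((2 *\<^sub>R p - 1) * (1 - S * S))"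
    using reflection_exists[OF p j pj c_def] by blast
  \<comment> \<open>The summand \<open>\<bar>\<beta>\<bar>\<close> brings the eigenvalues
    \<open>\<beta>\<close> and \<open>- \<beta>\<close> into \<open>[-K, K]\<close>, and 1 keeps
    \<open>K\<close> positive.\<close>
  define K where "K = 2 * norm c + \<bar>\<beta>\<bar> + 1"
  have c: "fcalc_dom K c"
    using norm_ge_zero[of c] abs_ge_zero[of \<beta>] adjc unfolding fcalc_dom_def K_def by linarith
  note c' = fcalc_dom_uminus[OF c]
  have \<beta>K: "\<bar>\<beta>\<bar> \<le> K"
    using norm_ge_zero[of c] abs_ge_zero[of \<beta>] unfolding K_def by linarith
  define d where "d n = 1 / real (Suc n)" for n
  have d: "0 < d n" for n by (simp add: d_def)
  define m where "m n = nat \<lceil>K / d n\<rceil>" for n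
  have m: "K \<le> d n * real (m n)" for n
  proof -
    have "K / d n \<le> real (m n)" unfolding m_def by (rule real_nat_ceiling_ge)
    then show ?thesis using d[of n] by (simp add: divide_le_eq mult.commute)
  qed
  \<comment> \<open>The Boolean selects between \<open>c\<close> and \<open>- c\<close>. All of
    these projections commute, which is enough for \<open>simple_trace_commuting\<close>; those
    belonging to one sign are nested and not orthogonal.\<close>
  define R where "R n i = spec_above K (if snd i then c else - c) (d n * real (fst i))" for n and i :: "nat \<times> bool"
  define r where "r n i = (if snd i then d n else - d n)" for n and i :: "nat \<times> bool"
  define I where "I n = {..<m n} \<times> (UNIV :: bool set)" for n
  have sumI: "(\<Sum>i\<in>I n. f i) = (\<Sum>k<m n. f (k, True)) + (\<Sum>k<m n. f (k, False))"
    for n and f :: "nat \<times> bool \<Rightarrow> 'b::comm_monoid_add"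
  proof -
    have "(\<Sum>i\<in>I n. f i) = (\<Sum>k<m n. \<Sum>b\<in>UNIV. f (k, b))"
      by (simp add: I_def sum.cartesian_product)
    then show ?thesis by (simp add: UNIV_bool sum.distrib add.commute)
  qed
  define s where "s n = \<beta> *\<^sub>R 1 + (\<Sum>i\<in>I n. r n i *\<^sub>R R n i)" for n
  have s_eq: "s n = \<beta> *\<^sub>R 1 + (d n *\<^sub>R (\<Sum>k<m n. spec_above K c (d n * real k))
      - d n *\<^sub>R (\<Sum>k<m n. spec_above K (- c) (d n * real k)))" for n
    by (simp add: s_def sumI r_def R_def sum_negf scaleR_sum_right)
  have finI: "finite (I n)" for n by (simp add: I_def)
  have projR: "\<forall>i\<in>I n. projection (R n i)" for n
    by (simp add: R_def spec_above_def projection_right_support)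
  have commR: "\<forall>i\<in>I n. \<forall>i'\<in>I n. R n i * R n i' = R n i' * R n i" for n
    unfolding R_def by (intro ballI spec_above_commute) (simp_all add: c c')
  have trace: "simple_trace D (s n) = \<beta> + d n * (\<Sum>k<m n. of_bool (d n * real k < \<beta>) - of_bool (d n * real k < - \<beta>)) * (2 * D p - 1)" for n
  proof -
    have "simple_trace D (s n) = \<beta> + (\<Sum>i\<in>I n. r n i * D (R n i))"
      unfolding s_def by (rule simple_trace_commuting(1)[OF D finI projR commR])
    also have "(\<Sum>i\<in>I n. r n i * D (R n i))
        = (\<Sum>k<m n. d n * (D (spec_above K c (d n * real k)) - D (spec_above K (- c) (d n * real k))))"
      by (simp add: sumI r_def R_def sum.distrib[symmetric] right_diff_distrib)
    also have "\<dots> = (\<Sum>k<m n. d n * ((of_bool (d n * real k < \<beta>) - of_bool (d n * real k < - \<beta>)) * (2 * D p - 1)))"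
      by (simp only: dimension_spec_above_diff[OF D p S c \<beta>K])
    also have "\<dots> = d n * (\<Sum>k<m n. of_bool (d n * real k < \<beta>) - of_bool (d n * real k < - \<beta>)) * (2 * D p - 1)"
      by (simp add: sum_distrib_left sum_distrib_right mult.assoc)
    finally show ?thesis .
  qed
  have d0: "d \<longlonglongrightarrow> 0" unfolding d_def by (rule LIMSEQ_Suc[OF lim_1_over_n])
  have small: "X \<longlonglongrightarrow> x" if "\<And>n. norm (X n - x) \<le> 2 * d n" for X :: "nat \<Rightarrow> 'b::real_normed_vector" and x
  proof -
    have "(\<lambda>n. X n - x) \<longlonglongrightarrow> 0"
      by (rule Lim_null_comparison[of _ "\<lambda>n. 2 * d n"])
         (use that tendsto_mult_right_zero[OF d0] in auto)
    then show ?thesis by (simp add: LIM_zero_iff)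
  qed
  have "simple_approx a s"
    unfolding simple_approx_def
  proof (intro conjI allI)
    fix n
    show "self_adjoint (s n)"
      unfolding self_adjoint_def s_eq by (simp add: adj_add adj_diff adj_scaleR adj_sum spec_above_def)
    show "finite (spectrum (s n))"
      unfolding s_def by (rule simple_trace_commuting(2)[OF D finI projR commR])
    have "s n \<in> B" if B: "aw_star_subalgebra B" "{a, 1} \<subseteq> B" for B
    proof -
      have "a \<in> B" and 1: "1 \<in> B" using B by auto
      have "c = a - \<beta> *\<^sub>R 1" by (simp add: ac)
      with \<open>a \<in> B\<close> 1 have "c \<in> B" by (simp add: aw_star_subalgebra_mem[OF B(1)])
      then have specB: "spec_above K c t \<in> B" "spec_above K (- c) t \<in> B" for t
        unfolding spec_above_def
        by (intro right_support_mem fcalc_mem B(1) 1 c c' continuous_ramp; simp add: aw_star_subalgebra_mem[OF B(1)])+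
      have sumB: "sum f {..<k} \<in> B" if "\<And>i. f i \<in> B" for f and k :: nat
        by (induction k) (auto intro: that aw_star_subalgebra_mem[OF B(1)])
      show ?thesis
        unfolding s_eq by (intro aw_star_subalgebra_mem[OF B(1)] 1 sumB specB)
    qed
    then show "s n \<in> aw_star_generated {a, 1}" unfolding aw_star_generated_def by blast
  next
    show "s \<longlonglongrightarrow> a"
    proof (rule small)
      fix n
      let ?g = "\<lambda>x::real. max x 0"
      \<comment> \<open>Writing \<open>c\<close> as the difference of its positive and negative
        parts reduces the error to two layer estimates of size \<open>d n\<close>.\<close>
      have eq: "s n - a = (fcalc K (- c) ?g - d n *\<^sub>R (\<Sum>k<m n. spec_above K (- c) (d n * real k)))
          - (fcalc K c ?g - d n *\<^sub>R (\<Sum>k<m n. spec_above K c (d n * real k)))"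
        unfolding s_eq ac by (subst (3) positive_negative_parts(1)[OF c, symmetric]) (simp add: algebra_simps)
      show "norm (s n - a) \<le> 2 * d n"
        unfolding eq
        using norm_triangle_ineq4 norm_positive_part_minus_step_le[OF c d m, of n]
          norm_positive_part_minus_step_le[OF c' d m, of n]
        by (smt (verit))
    qed
  qed
  then have "(\<lambda>n. simple_trace D (s n)) \<longlonglongrightarrow> q a"
    using q adja by (auto simp: quasi_trace_sa_def self_adjoint_def)
  moreover have "(\<lambda>n. d n * (\<Sum>k<m n. of_bool (d n * real k < \<beta>) - of_bool (d n * real k < - \<beta>))) \<longlonglongrightarrow> \<beta>"
  proof (rule small)
    fix n
    show "norm (d n * (\<Sum>k<m n. of_bool (d n * real k < \<beta>) - of_bool (d n * real k < - \<beta>)) - \<beta>) \<le> 2 * d n"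
      unfolding real_norm_def
      by (rule odd_step_function_approx[OF d order_trans[OF \<beta>K m]])
  qed
  then have "(\<lambda>n. simple_trace D (s n)) \<longlonglongrightarrow> \<beta> + \<beta> * (2 * D p - 1)"
    unfolding trace by (intro tendsto_intros)
  ultimately have "q a = \<beta> + \<beta> * (2 * D p - 1)" by (rule LIMSEQ_unique)
  then show ?thesis by (simp add: a_def \<beta>_def algebra_simps)
qed

section \<open>Left supports and idempotents\<close>

lemma left_support_eq_right_support_adj:
  "left_support x = right_support (adj x)"
proof -
  define p where "p = right_support (adj x)"
  have p: "projection p" unfolding p_def by (rule projection_right_support)
  have px: "p * x = x"
    using arg_cong[OF mult_right_support[of "adj x"], of adj] by (simp add: p_def adj_mult adj_adj)
  \<comment> \<open>Minimality is the annihilator property for \<open>adj x\<close>: the adjoint of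
    \<open>(1 - q) * x = 0\<close> is \<open>adj x * (1 - q) = 0\<close>.\<close>
  have min: "p * q = p" if q: "projection q" "q * x = x" for q
  proof -
    have "adj x * (1 - q) = adj ((1 - q) * x)" using q by (simp add: adj_mult adj_diff projection_def)
    also have "\<dots> = 0" using q by (simp add: left_diff_distrib)
    finally have "p * (1 - q) = 0" by (simp add: p_def right_support_mult_eq_0_iff)
    then show ?thesis by (simp add: right_diff_distrib)
  qed
  show ?thesis
    unfolding left_support_def p_def[symmetric]
  proof (rule the_equality)
    show "projection p \<and> p * x = x \<and> (\<forall>q. projection q \<and> q * x = x \<longrightarrow> p * q = p)"
      using p px min by blast
    fix r assume r: "projection r \<and> r * x = x \<and> (\<forall>q. projection q \<and> q * x = x \<longrightarrow> r * q = r)"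
    then have "r * p = r" "p * r = p" using p px min by blast+
    moreover have "adj (r * p) = p * r" using r p by (simp add: adj_mult projection_def)
    ultimately show "r = p" using r by (simp add: projection_def)
  qed
qed

theorem theorem6:
  fixes D :: "'a::aw_star_factor_II1 \<Rightarrow> real"
    and Q :: "'a \<Rightarrow> complex"
    and e :: 'a
    and l :: complex
  assumes "dimension_function D"
    and "quasi_trace D Q"
    and "e * e = e"
  shows "Q (l *\<^sub>C e) = l * complex_of_real (D (left_support e))"
proof -
  obtain q where q: "quasi_trace_sa D q"
    and Q: "\<And>x. Q x = complex_of_real (q (re_part x)) + \<i> * complex_of_real (q (im_part x))"
    using assms(2) unfolding quasi_trace_def by blast
  define p where "p = left_support e"
  have p_eq: "p = right_support (adj e)" unfolding p_def by (rule left_support_eq_right_support_adj)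
  have p: "projection p" unfolding p_eq by (rule projection_right_support)
  then have pp: "p * p = p" "adj p = p" by (auto simp: projection_def)
  have pe: "p * e = e"
    using arg_cong[OF mult_right_support[of "adj e"], of adj] by (simp add: p_eq adj_mult adj_adj)
  \<comment> \<open>This is where idempotency enters: \<open>adj e\<close> annihilates
    \<open>adj e - 1\<close>, hence so does its right support \<open>p\<close>. Thus
    \<open>e\<close> acts as the identity on its range, and \<open>x = e - p\<close> is purely
    off-diagonal.\<close>
  have ep: "e * p = p"
  proof -
    have "adj e * (adj e - 1) = 0"
      using arg_cong[OF assms(3), of adj] by (simp add: adj_mult right_diff_distrib)
    then have "p * (adj e - 1) = 0" by (simp add: p_eq right_support_mult_eq_0_iff)
    then have "p * adj e = p" by (simp add: right_diff_distrib)
    from arg_cong[OF this, of adj] show ?thesis by (simp add: adj_mult adj_adj pp)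
  qed
  define x where "x = e - p"
  have x: "p * x = x" "x * p = 0" by (simp_all add: x_def algebra_simps pe ep pp)
  \<comment> \<open>The form shared by the real and the imaginary part of
    \<open>l *\<^sub>C e\<close>: the first uses \<open>\<mu> = l / 2\<close>, the second
    \<open>\<mu> = l / (2 \<i>)\<close>.\<close>
  have main: "q (\<alpha> *\<^sub>R p + (\<mu> *\<^sub>C x + adj (\<mu> *\<^sub>C x))) = \<alpha> * D p" for \<alpha> \<mu>
  proof (rule quasi_trace_sa_offdiagonal[OF assms(1) q p])
    have "adj x * p = adj x" "p * adj x = 0"
      using arg_cong[OF x(1), of adj] arg_cong[OF x(2), of adj] by (simp_all add: adj_mult pp)
    then show "p * (\<mu> *\<^sub>C x + adj (\<mu> *\<^sub>C x)) + (\<mu> *\<^sub>C x + adj (\<mu> *\<^sub>C x)) * p = \<mu> *\<^sub>C x + adj (\<mu> *\<^sub>C x)"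
      by (simp add: adj_scaleC algebra_simps mult_scaleC_left mult_scaleC_right x)
  qed (simp add: adj_add adj_adj add.commute)
  have e: "e = p + x" by (simp add: x_def)
  have "re_part (l *\<^sub>C e) = (1/2 * l) *\<^sub>C p + (1/2 * cnj l) *\<^sub>C p
      + ((1/2 * l) *\<^sub>C x + adj ((1/2 * l) *\<^sub>C x))"
    by (simp add: re_part_def e adj_scaleC adj_add scaleC_add_right scaleC_scaleC pp)
  also have "(1/2 * l) *\<^sub>C p + (1/2 * cnj l) *\<^sub>C p = Re l *\<^sub>R p"
    unfolding scaleC_add_left[symmetric] scaleC_of_real[symmetric]
    by (rule arg_cong[of _ _ "\<lambda>z. z *\<^sub>C p"]) (simp add: complex_eq_iff)
  finally have re: "q (re_part (l *\<^sub>C e)) = Re l * D p" by (simp only: main)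
  define \<nu> where "\<nu> = 1 / (2 * \<i>) * l"
  \<comment> \<open>Conjugating \<open>1 / (2 \<i>)\<close> changes its sign, which turns the
    difference in \<open>im_part\<close> into the sum of an element and its adjoint that
    \<open>main\<close> expects.\<close>
  have \<nu>: "cnj \<nu> = - (1 / (2 * \<i>) * cnj l)" by (simp add: \<nu>_def)
  have "im_part (l *\<^sub>C e) = \<nu> *\<^sub>C p + cnj \<nu> *\<^sub>C p + (\<nu> *\<^sub>C x + adj (\<nu> *\<^sub>C x))"
    unfolding adj_scaleC \<nu>
    by (simp add: im_part_def e adj_scaleC adj_add scaleC_add_right scaleC_diff_right scaleC_scaleC
        scaleC_minus_left pp \<nu>_def)
  also have "\<nu> *\<^sub>C p + cnj \<nu> *\<^sub>C p = Im l *\<^sub>R p"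
    unfolding scaleC_add_left[symmetric] scaleC_of_real[symmetric]
    by (rule arg_cong[of _ _ "\<lambda>z. z *\<^sub>C p"]) (simp add: \<nu>_def complex_eq_iff)
  finally have im: "q (im_part (l *\<^sub>C e)) = Im l * D p" by (simp only: main)
  show ?thesis
    unfolding Q re im p_def[symmetric] by (simp add: complex_eq_iff)
qed

end
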